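(* For $x\in[x_0,x_1]$ let $B(x)$ be the triangular model depending on $x$ described in the context, with $B(x)^*=-UB(x)U^*$ for a unitary $U$, let $A(x)=bB^2(x)$ ($b\in\mathbb R$, $b\neq0$), and let $A(x),B(x)$ be embedded in the strict colligation $X=(A(x),B(x);H,\widetilde\Phi(x),\mathbb C^{2m};\sigma_A,\sigma_B,\psi(x),\widetilde\psi(x))$ of the context, where $$\psi=\begin{pmatrix}bL\psi_{11}L&ibL\psi_{12}L\\-ibL\psi_{12}^*L&bL\end{pmatrix},\qquad \widetilde\psi=\begin{pmatrix}bL\widetilde\psi_{11}L&ibL\widetilde\psi_{12}L\\-ibL\widetilde\psi_{12}^*L&bL\end{pmatrix},\qquad \psi_{11}^*=\psi_{11},\ \widetilde\psi_{11}^*=\widetilde\psi_{11}.$$ Let $\lambda\in\mathbb C$ lie outside the spectrum of $A(x)$ and let $u(x,t)=e^{-\lambda t}u_\lambda(x)=e^{-\lambda t}(u_1(x),u_2(x))$, $f(x,t)=e^{-\lambda t}f_\lambda(x)$, $v(x,t)=e^{-\lambda t}v_\lambda(x)=e^{-\lambda t}(v_1(x),v_2(x))$ be the input, state and output of the open system $$\frac{\partial f}{\partial t}+A(x)f=\widetilde\Phi^*(x)\sigma_Au,\quad i\frac{\partial f}{\partial x}+B(x)f=\widetilde\Phi^*(x)\sigma_Bu,\quad v=u-i\widetilde\Phi(x)f .$$ Then the input and the output satisfy the compatibility conditions $$\frac{du_\lambda}{dx}-i\sigma_A^{-1}(\lambda\sigma_B+\psi(x))u_\lambda=0,\qquad \frac{dv_\lambda}{dx}-i\sigma_A^{-1}(\lambda\sigma_B+\widetilde\psi(x))v_\lambda=0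 ,$$ and, in the case when $$\psi_{12}=\psi_{12}^*,\quad -\psi_{12}L\psi_{11}+\psi_{11}L\psi_{12}^*+\frac{d\psi_{11}}{dx}=0,\quad \widetilde\psi_{12}=\widetilde\psi_{12}^*,\quad -\widetilde\psi_{12}L\widetilde\psi_{11}+\widetilde\psi_{11}L\widetilde\psi_{12}^*+\frac{d\widetilde\psi_{11}}{dx}=0,$$ the characteristic operator function $W_A(\lambda)=I-i\widetilde\Phi(A-\lambda I)^{-1}\widetilde\Phi^*\sigma_A$ maps the input $u_\lambda=(u_1,u_2)$, satisfying the Sturm–Liouville equations $$-\frac{d^2u_1}{dx^2}+u_1\Big((L\psi_{12})^2-L\psi_{11}-L\frac{d\psi_{12}}{dx}\Big)=\frac\lambda bu_1,\qquad -\frac{d^2u_2}{dx^2}+u_2\Big((L\psi_{12})^2-L\psi_{11}+L\frac{d\psi_{12}}{dx}\Big)=\frac\lambda bu_2,$$ to the output $v_\lambda=(v_1,v_2)=W_A(\lambda)u_\lambda$, whose components are solutions of the Sturm–Liouville equations $$-\frac{d^2v_1}{dx^2}+v_1\Big((L\widetilde\psi_{12})^2-L\widetilde\psi_{11}-L\frac{d\widetilde\psi_{12}}{dx}\Big)=\frac\lambda bv_1,\qquad -\frac{d^2v_2}{dx^2}+v_2\Big((L\widetilde\psi_{12})^2-L\widetilde\psi_{11}+L\frac{d\widetilde\psi_{12}}{dx}\Big)=\frac\lambda bv_2 .$$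
   Context: Conventions. Elements of $\mathbb C^k$ are row vectors and every matrix $K$, including the block matrices $\sigma_A,\sigma_B,\psi(x),\widetilde\psi(x)$ on $\mathbb C^{2m}=(\mathbb C^m)^2$, acts by right multiplication: the operator written $Ku$ is $u\mapsto uK$ (e.g. $\psi u_\lambda$ means $(u_1,u_2)\psi$). Products of operators are compositions. Triangular model. $1\le p\le m$, $\Delta=[-l,l]$, $H=\mathbf L^2(\Delta;\mathbb C^p)$. $L$ is an invertible Hermitian $m\times m$ matrix with $L=J_1-J_2+S_0+S_0^*$, $J_1=\begin{pmatrix}I_r&0\\0&0\end{pmatrix}$, $J_2=\begin{pmatrix}0&0\\0&I_{m-r}\end{pmatrix}$, $S_0=\begin{pmatrix}0&0\\ \widehat S&0\end{pmatrix}$, with $r$, $m-r$ the numbers of positive and negative eigenvalues of $L$. For each $x$, $\Pi(\cdot,x)$ is a measurable $p\times m$ matrix function on $\Delta$ with rows linearly independent at each point of a set of positive measure, and $\widetilde\Pi=\Pi^*\Pi$ satisfies $\operatorname{tr}\widetilde\Pi=1$, $\widetilde\Pi J_1=J_1\widetilde\Pi$ and a Hölder condition in $w$. Then $$(B(x)f)(w)=wf(w)-i\int_{-l}^{w}f(\xi)\Pi(\xi,x)S_0^*\Pi^*(w,x)d\xi+i\int_w^{l}f(\xi)\Pi(\xi,x)S_0\Pi^*(w,x)d\xi+i\int_{-l}^{w}f(\xi)\Pi(\xi,x)L\Pi^*(w,x)d\xi,$$ $\Phi(x)f=\int_\Delta f(w)\Pi(w,x)dw$, $\widetilde\Phi(x)f=(\Phi(x)f,\Phi(x)B^*(x)f)$,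 $\sigma_A=\begin{pmatrix}0&bL\\ bL&0\end{pmatrix}$, $\sigma_B=\begin{pmatrix}L&0\\0&0\end{pmatrix}$. Colligation depending on $x$. $\psi(x),\widetilde\psi(x)$ are selfadjoint, $\widetilde\Phi(x)$ is differentiable, and $$\tfrac{A-A^*}{i}=\widetilde\Phi^*\sigma_A\widetilde\Phi,\quad \tfrac{B-B^*}{i}=\widetilde\Phi^*\sigma_B\widetilde\Phi,\quad \tfrac1i\sigma_A\tfrac{d\widetilde\Phi}{dx}+\sigma_A\widetilde\Phi B^*-\sigma_B\widetilde\Phi A^*=\psi\widetilde\Phi,$$ $$\tfrac1i\sigma_A\tfrac{d\widetilde\Phi}{dx}+\sigma_A\widetilde\Phi B-\sigma_B\widetilde\Phi A=\widetilde\psi\widetilde\Phi,\quad \widetilde\psi=\psi+i(\sigma_A\widetilde\Phi\widetilde\Phi^*\sigma_B-\sigma_B\widetilde\Phi\widetilde\Phi^*\sigma_A),\quad i\tfrac{dA}{dx}=AB-BA .$$ "Strict" means $\widetilde\Phi(x)H=\mathbb C^{2m}$. The blocks $\psi_{jk},\widetilde\psi_{jk}$ are differentiable functions of $x$, and $u_\lambda,f_\lambda,v_\lambda$ are differentiable. *)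

theory Defs
  imports "HOL-Analysis.Analysis" "HOL-Computational_Algebra.Polynomial"
begin

section \<open>Row vectors and block matrices\<close>

text \<open>
  Elements of the spaces \<open>C^k\<close> are row vectors and a matrix \<open>K\<close> acts as \<open>u \<mapsto> u v* K\<close>.  Hence a
  composition of matrix operators, rightmost factor applied first, is an iterated \<open>v*\<close>.
\<close>

definition cadj :: "complex^'n^'m \<Rightarrow> complex^'m^'n" where
  "cadj M = (\<chi> i j. cnj (M $ j $ i))"

definition mscale :: "complex \<Rightarrow> complex^'n^'m \<Rightarrow> complex^'n^'m" (infixr "*\<^sub>M" 75) where
  "c *\<^sub>M M = (\<chi> i j. c * M $ i $ j)"

definition block ::
  "complex^'m^'m \<Rightarrow> complex^'m^'m \<Rightarrow> complex^'m^'m \<Rightarrow> complex^'m^'m \<Rightarrow> complex^('m + 'm)^('m + 'm)" where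
  "block M11 M12 M21 M22 = (\<chi> i j.
     case i of
       Inl a \<Rightarrow> (case j of Inl c \<Rightarrow> M11 $ a $ c | Inr d \<Rightarrow> M12 $ a $ d)
     | Inr a \<Rightarrow> (case j of Inl c \<Rightarrow> M21 $ a $ c | Inr d \<Rightarrow> M22 $ a $ d))"

definition vpair :: "complex^'m \<Rightarrow> complex^'m \<Rightarrow> complex^('m + 'm)" where
  "vpair u1 u2 = (\<chi> i. case i of Inl a \<Rightarrow> u1 $ a | Inr a \<Rightarrow> u2 $ a)"

definition charpoly :: "complex^'m^'m \<Rightarrow> complex poly" where
  "charpoly M = det (\<chi> i j. (if i = j then [:0, 1:] else 0) - [:M $ i $ j:])"

text \<open>Eigenvalues are counted with algebraic multiplicity.\<close>

definition num_pos_eigenvalues :: "complex^'m^'m \<Rightarrow> nat" where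
  "num_pos_eigenvalues M =
     (\<Sum>z | poly (charpoly M) z = 0 \<and> z \<in> \<real> \<and> Re z > 0. order z (charpoly M))"

definition num_neg_eigenvalues :: "complex^'m^'m \<Rightarrow> nat" where
  "num_neg_eigenvalues M =
     (\<Sum>z | poly (charpoly M) z = 0 \<and> z \<in> \<real> \<and> Re z < 0. order z (charpoly M))"

text \<open>
  The indices \<open>1, \<dots>, m\<close> are the elements of a finite linearly ordered type; the first block
  consists of the \<open>r\<close> smallest ones.
\<close>

definition first_block :: "nat \<Rightarrow> 'm::{finite,linorder} \<Rightarrow> bool" where
  "first_block r i \<longleftrightarrow> card {j. j < i} < r"

definition J1 :: "nat \<Rightarrow> complex^('m::{finite,linorder})^('m::{finite,linorder})" where
  "J1 r = (\<chi> i j. if i = j \<and> first_block r i then 1 else 0)"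

definition J2 :: "nat \<Rightarrow> complex^('m::{finite,linorder})^('m::{finite,linorder})" where
  "J2 r = (\<chi> i j. if i = j \<and> \<not> first_block r i then 1 else 0)"

definition lower_left :: "nat \<Rightarrow> complex^('m::{finite,linorder})^('m::{finite,linorder}) \<Rightarrow> bool" where
  "lower_left r S0 \<longleftrightarrow>
     (\<forall>i j. \<not> (\<not> first_block r i \<and> first_block r j) \<longrightarrow> S0 $ i $ j = 0)"

section \<open>The space of square-integrable functions\<close>

text \<open>
  \<open>'p L2\<close> is the space of square-integrable functions from the real line to \<open>C^p\<close> modulo
  equality almost everywhere.  The space \<open>L\<^sup>2(D; C^p)\<close> is identified with the closed subspace
  \<open>L2_on D\<close> of the functions vanishing almost everywhere outside \<open>D\<close>, and an operator defined on
  it with its extension by zero to the orthogonal complement \<open>L2_on (- D)\<close>.  This changes neither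
  operator norms nor (up to the same extension by zero) adjoints.
\<close>

definition sq_integrable :: "(real \<Rightarrow> complex^'p) \<Rightarrow> bool" where
  "sq_integrable f \<longleftrightarrow>
     f \<in> borel_measurable lebesgue \<and> integrable lebesgue (\<lambda>w. (norm (f w))\<^sup>2)"

lemma sq_integrable_zero: "sq_integrable (\<lambda>w. 0)"
  by (simp add: sq_integrable_def)

lemma sq_integrable_add:
  assumes "sq_integrable f" "sq_integrable g"
  shows "sq_integrable (\<lambda>w. f w + g w)"
proof -
  have m: "(\<lambda>w. f w + g w) \<in> borel_measurable lebesgue"
    using assms by (auto simp: sq_integrable_def)
  have "integrable lebesgue (\<lambda>w. 2 * (norm (f w))\<^sup>2 + 2 * (norm (g w))\<^sup>2)"
    using assms by (auto simp: sq_integrable_def)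
  then have "integrable lebesgue (\<lambda>w. (norm (f w + g w))\<^sup>2)"
  proof (rule Bochner_Integration.integrable_bound)
    show "AE w in lebesgue. norm ((norm (f w + g w))\<^sup>2)
        \<le> norm (2 * (norm (f w))\<^sup>2 + 2 * (norm (g w))\<^sup>2)"
    proof (rule AE_I2)
      fix w
      have "(norm (f w + g w))\<^sup>2 \<le> (norm (f w) + norm (g w))\<^sup>2"
        by (intro power_mono norm_triangle_ineq) auto
      also have "\<dots> \<le> 2 * (norm (f w))\<^sup>2 + 2 * (norm (g w))\<^sup>2"
        using sum_squares_bound[of "norm (f w)" "norm (g w)"] by (simp add: power2_sum)
      finally show "norm ((norm (f w + g w))\<^sup>2)
          \<le> norm (2 * (norm (f w))\<^sup>2 + 2 * (norm (g w))\<^sup>2)"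
        by simp
    qed
  qed (use m in measurable)
  then show ?thesis using m by (simp add: sq_integrable_def)
qed

lemma norm_vector_scalar_mult: "norm (c *s v) = cmod c * norm (v :: complex^'p)"
  by (simp add: norm_vec_def vector_scalar_mult_def norm_mult L2_set_right_distrib)

lemma continuous_vector_scalar_mult: "continuous_on UNIV (\<lambda>v :: complex^'p. c *s v)"
  unfolding vector_scalar_mult_def by (intro continuous_intros)

lemma sq_integrable_scale:
  assumes "sq_integrable f"
  shows "sq_integrable (\<lambda>w. c *s f w)"
proof -
  have "(\<lambda>w. c *s f w) \<in> borel_measurable lebesgue"
    using assms borel_measurable_continuous_onI[OF continuous_vector_scalar_mult[of c]]
    by (auto simp: sq_integrable_def intro: measurable_compose)
  then show ?thesis
    using assms by (simp add: sq_integrable_def norm_vector_scalar_mult power_mult_distrib)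
qed

lemma scaleR_eq_vector_scalar_mult: "a *\<^sub>R v = complex_of_real a *s (v :: complex^'p)"
  by (simp add: vec_eq_iff scaleR_conv_of_real[where 'a = complex])

lemma sq_integrable_scaleR: "sq_integrable f \<Longrightarrow> sq_integrable (\<lambda>w. a *\<^sub>R f w)"
  by (simp add: scaleR_eq_vector_scalar_mult sq_integrable_scale)

lemma sq_integrable_uminus: "sq_integrable f \<Longrightarrow> sq_integrable (\<lambda>w. - f w)"
  using sq_integrable_scaleR[of f "-1"] by simp

lemma sq_integrable_diff:
  "sq_integrable f \<Longrightarrow> sq_integrable g \<Longrightarrow> sq_integrable (\<lambda>w. f w - g w)"
  using sq_integrable_add[of f "\<lambda>w. - g w"] sq_integrable_uminus[of g] by simp

lemma sq_integrable_inner: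
  assumes "sq_integrable f" "sq_integrable g"
  shows "integrable lebesgue (\<lambda>w. f w \<bullet> g w)"
proof -
  have "integrable lebesgue (\<lambda>w. (norm (f w))\<^sup>2 + (norm (g w))\<^sup>2)"
    using assms by (auto simp: sq_integrable_def)
  then show ?thesis
  proof (rule Bochner_Integration.integrable_bound)
    show "AE w in lebesgue. norm (f w \<bullet> g w) \<le> norm ((norm (f w))\<^sup>2 + (norm (g w))\<^sup>2)"
    proof (rule AE_I2)
      fix w
      have "\<bar>f w \<bullet> g w\<bar> \<le> norm (f w) * norm (g w)"
        by (rule Cauchy_Schwarz_ineq2)
      also have "\<dots> \<le> (norm (f w))\<^sup>2 + (norm (g w))\<^sup>2"
        using sum_squares_bound[of "norm (f w)" "norm (g w)"]
          mult_nonneg_nonneg[OF norm_ge_zero[of "f w"] norm_ge_zero[of "g w"]] by linarith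
      finally show "norm (f w \<bullet> g w) \<le> norm ((norm (f w))\<^sup>2 + (norm (g w))\<^sup>2)"
        by simp
    qed
  qed (use assms in \<open>auto simp: sq_integrable_def\<close>)
qed

definition L2_rel :: "(real \<Rightarrow> complex^'p) \<Rightarrow> (real \<Rightarrow> complex^'p) \<Rightarrow> bool" where
  "L2_rel f g \<longleftrightarrow> sq_integrable f \<and> sq_integrable g \<and> (AE w in lebesgue. f w = g w)"

quotient_type 'p L2 = "real \<Rightarrow> complex^('p::finite)" / partial: L2_rel
proof (rule part_equivpI)
  show "\<exists>f :: real \<Rightarrow> complex^'p. L2_rel f f"
    using sq_integrable_zero by (auto simp: L2_rel_def)
  show "symp L2_rel"
    by (auto simp: symp_def L2_rel_def)
  show "transp L2_rel"
    by (auto simp: transp_def L2_rel_def)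
qed

lift_definition scaleC_L2 :: "complex \<Rightarrow> ('p::finite) L2 \<Rightarrow> 'p L2" (infixr "*\<^sub>C" 75)
  is "\<lambda>c f w. c *s f w"
  by (auto simp: L2_rel_def sq_integrable_scale)

text \<open>The real inner product is the real part of the complex one, as for \<open>complex ^ 'n\<close>.\<close>

instantiation L2 :: (finite) real_inner
begin

lift_definition zero_L2 :: "'a L2" is "\<lambda>w. 0"
  by (simp add: L2_rel_def sq_integrable_zero)

lift_definition plus_L2 :: "'a L2 \<Rightarrow> 'a L2 \<Rightarrow> 'a L2" is "\<lambda>f g w. f w + g w"
  by (auto simp: L2_rel_def sq_integrable_add)

lift_definition minus_L2 :: "'a L2 \<Rightarrow> 'a L2 \<Rightarrow> 'a L2" is "\<lambda>f g w. f w - g w"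
  by (auto simp: L2_rel_def sq_integrable_diff)

lift_definition uminus_L2 :: "'a L2 \<Rightarrow> 'a L2" is "\<lambda>f w. - f w"
  by (auto simp: L2_rel_def sq_integrable_uminus)

lift_definition scaleR_L2 :: "real \<Rightarrow> 'a L2 \<Rightarrow> 'a L2" is "\<lambda>a f w. a *\<^sub>R f w"
  by (auto simp: L2_rel_def sq_integrable_scaleR)

lift_definition inner_L2 :: "'a L2 \<Rightarrow> 'a L2 \<Rightarrow> real"
  is "\<lambda>f g. LINT w|lebesgue. f w \<bullet> g w"
proof -
  fix f f' g g' :: "real \<Rightarrow> complex^'a"
  assume fg: "L2_rel f f'" "L2_rel g g'"
  show "(LINT w|lebesgue. f w \<bullet> g w) = (LINT w|lebesgue. f' w \<bullet> g' w)"
  proof (rule integral_cong_AE)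
    show "AE w in lebesgue. f w \<bullet> g w = f' w \<bullet> g' w"
      using fg by (auto simp: L2_rel_def elim: eventually_elim2)
  qed (use fg in \<open>auto simp: L2_rel_def sq_integrable_def\<close>)
qed

definition norm_L2 :: "'a L2 \<Rightarrow> real" where
  "norm_L2 f = sqrt (f \<bullet> f)"

definition dist_L2 :: "'a L2 \<Rightarrow> 'a L2 \<Rightarrow> real" where
  "dist_L2 f g = norm (f - g)"

definition sgn_L2 :: "'a L2 \<Rightarrow> 'a L2" where
  "sgn_L2 f = inverse (norm f) *\<^sub>R f"

definition uniformity_L2 :: "('a L2 \<times> 'a L2) filter" where
  "uniformity_L2 = (INF e\<in>{0<..}. principal {(x, y). dist x y < e})"

definition open_L2 :: "'a L2 set \<Rightarrow> bool" where
  "open_L2 W \<longleftrightarrow> (\<forall>x\<in>W. \<forall>\<^sub>F (x', y) in uniformity. x' = x \<longrightarrow> y \<in> W)"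

instance
proof
  fix f g h :: "'a L2" and a c :: real
  show "f + g + h = f + (g + h)"
    by transfer (auto simp: L2_rel_def algebra_simps intro!: sq_integrable_add)
  show "f + g = g + f"
    by transfer (auto simp: L2_rel_def algebra_simps intro!: sq_integrable_add)
  show "0 + f = f"
    by transfer (auto simp: L2_rel_def)
  show "- f + f = 0"
    by transfer (auto simp: L2_rel_def sq_integrable_zero)
  show "f - g = f + - g"
    by transfer (auto simp: L2_rel_def sq_integrable_diff)
  show "a *\<^sub>R (f + g) = a *\<^sub>R f + a *\<^sub>R g"
    by transfer (auto simp: L2_rel_def scaleR_add_right
        intro!: sq_integrable_add sq_integrable_scaleR)
  show "(a + c) *\<^sub>R f = a *\<^sub>R f + c *\<^sub>R f"
    by transfer (auto simp: L2_rel_def scaleR_add_left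
        intro!: sq_integrable_add sq_integrable_scaleR)
  show "a *\<^sub>R c *\<^sub>R f = (a * c) *\<^sub>R f"
    by transfer (auto simp: L2_rel_def intro!: sq_integrable_scaleR)
  show "1 *\<^sub>R f = f"
    by transfer (auto simp: L2_rel_def)
  show "dist f g = norm (f - g)"
    by (rule dist_L2_def)
  show "sgn f = inverse (norm f) *\<^sub>R f"
    by (rule sgn_L2_def)
  show "uniformity = (INF e\<in>{0<..}. principal {(x, y :: 'a L2). dist x y < e})"
    by (rule uniformity_L2_def)
  show "open W \<longleftrightarrow> (\<forall>x\<in>W. \<forall>\<^sub>F (x', y) in uniformity. x' = x \<longrightarrow> y \<in> W)" for W :: "'a L2 set"
    by (rule open_L2_def)
  show "f \<bullet> g = g \<bullet> f"
    by transfer (simp add: inner_commute)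
  show "(f + g) \<bullet> h = f \<bullet> h + g \<bullet> h"
    by transfer (auto simp: L2_rel_def inner_add_left sq_integrable_inner)
  show "a *\<^sub>R f \<bullet> g = a * (f \<bullet> g)"
    by transfer simp
  show "0 \<le> f \<bullet> f"
    by transfer (simp add: integral_nonneg_AE)
  show "f \<bullet> f = 0 \<longleftrightarrow> f = 0"
  proof transfer
    fix f :: "real \<Rightarrow> complex^'a"
    assume "L2_rel f f"
    then have f: "sq_integrable f" by (simp add: L2_rel_def)
    show "(LINT w|lebesgue. f w \<bullet> f w) = 0 \<longleftrightarrow> L2_rel f (\<lambda>w. 0)"
      using integral_nonneg_eq_0_iff_AE[OF sq_integrable_inner[OF f f]] f
      by (simp add: L2_rel_def sq_integrable_zero)
  qed
  show "norm f = sqrt (f \<bullet> f)"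
    by (rule norm_L2_def)
qed

end

definition L2_on :: "real set \<Rightarrow> ('p::finite) L2 set" where
  "L2_on D = {f. AE w in lebesgue. w \<notin> D \<longrightarrow> rep_L2 f w = 0}"

section \<open>Operators\<close>

text \<open>
  Adjoints are expressed by the library constant \<open>adjoint\<close> for the real inner products.  Since
  these are the real parts of the complex ones, it is the usual adjoint for complex linear
  operators.
\<close>

definition bounded_op_on :: "real set \<Rightarrow> (('p::finite) L2 \<Rightarrow> 'p L2) \<Rightarrow> bool" where
  "bounded_op_on D T \<longleftrightarrow>
     bounded_linear T \<and> (\<forall>c f. T (c *\<^sub>C f) = c *\<^sub>C T f) \<and>
     range T \<subseteq> L2_on D \<and> (\<forall>f\<in>L2_on (- D). T f = 0)"

definition unitary_on :: "real set \<Rightarrow> (('p::finite) L2 \<Rightarrow> 'p L2) \<Rightarrow> bool" where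
  "unitary_on D U \<longleftrightarrow>
     bounded_op_on D U \<and> (\<forall>f\<in>L2_on D. U (adjoint U f) = f \<and> adjoint U (U f) = f)"

definition spectrum_on :: "real set \<Rightarrow> (('p::finite) L2 \<Rightarrow> 'p L2) \<Rightarrow> complex set" where
  "spectrum_on D T =
     {z. \<not> (\<exists>R. bounded_op_on D R \<and>
            (\<forall>f\<in>L2_on D. R (T f - z *\<^sub>C f) = f \<and> T (R f) - z *\<^sub>C R f = f))}"

text \<open>Differentiability of operator functions is meant in the operator norm.\<close>

definition has_op_derivative ::
  "(real \<Rightarrow> 'a::real_normed_vector \<Rightarrow> 'b::real_normed_vector) \<Rightarrow> ('a \<Rightarrow> 'b) \<Rightarrow> real \<Rightarrow> real set \<Rightarrow> bool" where
  "has_op_derivative T T' x S \<longleftrightarrow>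
     (\<forall>y\<in>S. bounded_linear (T y)) \<and> bounded_linear T' \<and>
     ((\<lambda>y. Blinfun (T y)) has_vector_derivative Blinfun T') (at x within S)"

section \<open>The triangular model\<close>

text \<open>Here and below \<open>P\<close> is the matrix function \<open>w \<mapsto> \<Pi>(w, x)\<close> for a fixed \<open>x\<close>.\<close>

definition triangular_model_data ::
  "real \<Rightarrow> nat \<Rightarrow> complex^('m::{finite,linorder})^('m::{finite,linorder})
    \<Rightarrow> complex^('m::{finite,linorder})^('m::{finite,linorder})
    \<Rightarrow> (real \<Rightarrow> complex^('m::{finite,linorder})^('p::finite)) \<Rightarrow> bool" where
  "triangular_model_data l r L S0 P \<longleftrightarrow>
     0 < l \<and> CARD('p) \<le> CARD('m) \<and>
     cadj L = L \<and> invertible L \<and> lower_left r S0 \<and> L = J1 r - J2 r + S0 + cadj S0 \<and>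
     r \<le> CARD('m) \<and> num_pos_eigenvalues L = r \<and> num_neg_eigenvalues L = CARD('m) - r \<and>
     P \<in> borel_measurable (lebesgue_on {-l..l}) \<and>
     (\<exists>E\<in>sets lebesgue. E \<subseteq> {-l..l} \<and> emeasure lebesgue E > 0 \<and>
        (\<forall>w\<in>E. inj (\<lambda>i. row i (P w)) \<and> vec.independent (range (\<lambda>i. row i (P w))))) \<and>
     (\<forall>w\<in>{-l..l}. trace (cadj (P w) ** P w) = 1 \<and>
        (cadj (P w) ** P w) ** J1 r = J1 r ** (cadj (P w) ** P w)) \<and>
     (\<exists>C \<alpha>. 0 < \<alpha> \<and> \<alpha> \<le> 1 \<and>
        (\<forall>w\<in>{-l..l}. \<forall>w'\<in>{-l..l}.
           norm (cadj (P w) ** P w - cadj (P w') ** P w') \<le> C * \<bar>w - w'\<bar> powr \<alpha>))"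

definition triangular_fun ::
  "real \<Rightarrow> complex^'m^'m \<Rightarrow> complex^'m^'m \<Rightarrow> (real \<Rightarrow> complex^'m^'p)
    \<Rightarrow> (real \<Rightarrow> complex^'p) \<Rightarrow> real \<Rightarrow> complex^'p" where
  "triangular_fun l L S0 P f w =
     complex_of_real w *s f w
     - \<i> *s (LINT \<xi>:{-l..w}|lebesgue. f \<xi> v* P \<xi> v* cadj S0 v* cadj (P w))
     + \<i> *s (LINT \<xi>:{w..l}|lebesgue. f \<xi> v* P \<xi> v* S0 v* cadj (P w))
     + \<i> *s (LINT \<xi>:{-l..w}|lebesgue. f \<xi> v* P \<xi> v* L v* cadj (P w))"

definition triangular_op ::
  "real \<Rightarrow> complex^'m^'m \<Rightarrow> complex^'m^'m \<Rightarrow> (real \<Rightarrow> complex^'m^('p::finite))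
    \<Rightarrow> 'p L2 \<Rightarrow> 'p L2" where
  "triangular_op l L S0 P f =
     abs_L2 (\<lambda>w. if w \<in> {-l..l} then triangular_fun l L S0 P (rep_L2 f) w else 0)"

definition model_channel ::
  "real \<Rightarrow> (real \<Rightarrow> complex^'m^('p::finite)) \<Rightarrow> 'p L2 \<Rightarrow> complex^'m" where
  "model_channel l P f = (LINT w:{-l..l}|lebesgue. rep_L2 f w v* P w)"

definition double_channel ::
  "('h::real_inner \<Rightarrow> complex^'m) \<Rightarrow> ('h \<Rightarrow> 'h) \<Rightarrow> 'h \<Rightarrow> complex^('m + 'm)" where
  "double_channel \<Phi> B f = vpair (\<Phi> f) (\<Phi> (adjoint B f))"

definition sigma_A :: "real \<Rightarrow> complex^'m^'m \<Rightarrow> complex^('m + 'm)^('m + 'm)" where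
  "sigma_A b L = block 0 (of_real b *\<^sub>M L) (of_real b *\<^sub>M L) 0"

definition sigma_B :: "complex^'m^'m \<Rightarrow> complex^('m + 'm)^('m + 'm)" where
  "sigma_B L = block L 0 0 0"

definition psi_form ::
  "real \<Rightarrow> complex^'m^'m \<Rightarrow> complex^'m^'m \<Rightarrow> complex^'m^'m \<Rightarrow> complex^('m + 'm)^('m + 'm)" where
  "psi_form b L N11 N12 =
     block (of_real b *\<^sub>M (L ** N11 ** L)) ((\<i> * of_real b) *\<^sub>M (L ** N12 ** L))
           (- ((\<i> * of_real b) *\<^sub>M (L ** cadj N12 ** L))) (of_real b *\<^sub>M L)"

section \<open>Colligations and open systems\<close>

definition colligation ::
  "real set \<Rightarrow> real set \<Rightarrow> (real \<Rightarrow> ('p::finite) L2 \<Rightarrow> 'p L2) \<Rightarrow> (real \<Rightarrow> 'p L2 \<Rightarrow> 'p L2)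
    \<Rightarrow> (real \<Rightarrow> 'p L2 \<Rightarrow> complex^'n) \<Rightarrow> complex^'n^'n \<Rightarrow> complex^'n^'n
    \<Rightarrow> (real \<Rightarrow> complex^'n^'n) \<Rightarrow> (real \<Rightarrow> complex^'n^'n) \<Rightarrow> bool" where
  "colligation S D A B \<Phi> \<sigma>A \<sigma>B \<psi> \<psi>' \<longleftrightarrow> (\<forall>x\<in>S.
     cadj (\<psi> x) = \<psi> x \<and> cadj (\<psi>' x) = \<psi>' x \<and>
     (\<forall>f\<in>L2_on D. (1 / \<i>) *\<^sub>C (A x f - adjoint (A x) f) = adjoint (\<Phi> x) (\<Phi> x f v* \<sigma>A)) \<and>
     (\<forall>f\<in>L2_on D. (1 / \<i>) *\<^sub>C (B x f - adjoint (B x) f) = adjoint (\<Phi> x) (\<Phi> x f v* \<sigma>B)) \<and>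
     (\<exists>d\<Phi>. has_op_derivative \<Phi> d\<Phi> x S \<and>
        (\<forall>f\<in>L2_on D.
           (1 / \<i>) *s (d\<Phi> f v* \<sigma>A) + \<Phi> x (adjoint (B x) f) v* \<sigma>A
             - \<Phi> x (adjoint (A x) f) v* \<sigma>B = \<Phi> x f v* \<psi> x) \<and>
        (\<forall>f\<in>L2_on D.
           (1 / \<i>) *s (d\<Phi> f v* \<sigma>A) + \<Phi> x (B x f) v* \<sigma>A
             - \<Phi> x (A x f) v* \<sigma>B = \<Phi> x f v* \<psi>' x)) \<and>
     (\<forall>h. h v* \<psi>' x = h v* \<psi> x
        + \<i> *s (\<Phi> x (adjoint (\<Phi> x) (h v* \<sigma>B)) v* \<sigma>A
               - \<Phi> x (adjoint (\<Phi> x) (h v* \<sigma>A)) v* \<sigma>B)) \<and>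
     (\<exists>dA. has_op_derivative A dA x S \<and>
        (\<forall>f\<in>L2_on D. \<i> *\<^sub>C dA f = A x (B x f) - B x (A x f))))"

definition strict_colligation ::
  "real set \<Rightarrow> real set \<Rightarrow> (real \<Rightarrow> ('p::finite) L2 \<Rightarrow> complex^'n) \<Rightarrow> bool" where
  "strict_colligation S D \<Phi> \<longleftrightarrow> (\<forall>x\<in>S. \<Phi> x ` L2_on D = UNIV)"

definition open_system ::
  "real set \<Rightarrow> (real \<Rightarrow> ('p::finite) L2 \<Rightarrow> 'p L2) \<Rightarrow> (real \<Rightarrow> 'p L2 \<Rightarrow> 'p L2)
    \<Rightarrow> (real \<Rightarrow> 'p L2 \<Rightarrow> complex^'n) \<Rightarrow> complex^'n^'n \<Rightarrow> complex^'n^'n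
    \<Rightarrow> (real \<Rightarrow> real \<Rightarrow> complex^'n) \<Rightarrow> (real \<Rightarrow> real \<Rightarrow> 'p L2) \<Rightarrow> (real \<Rightarrow> real \<Rightarrow> complex^'n) \<Rightarrow> bool" where
  "open_system S A B \<Phi> \<sigma>A \<sigma>B u f v \<longleftrightarrow> (\<forall>x\<in>S. \<forall>t.
     (\<exists>df. ((\<lambda>s. f x s) has_vector_derivative df) (at t) \<and>
        df + A x (f x t) = adjoint (\<Phi> x) (u x t v* \<sigma>A)) \<and>
     (\<exists>df. ((\<lambda>y. f y t) has_vector_derivative df) (at x within S) \<and>
        \<i> *\<^sub>C df + B x (f x t) = adjoint (\<Phi> x) (u x t v* \<sigma>B)) \<and>
     v x t = u x t - \<i> *s \<Phi> x (f x t))"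

definition characteristic_op ::
  "real set \<Rightarrow> (('p::finite) L2 \<Rightarrow> 'p L2) \<Rightarrow> ('p L2 \<Rightarrow> complex^'n) \<Rightarrow> complex^'n^'n
    \<Rightarrow> complex \<Rightarrow> complex^'n \<Rightarrow> complex^'n" where
  "characteristic_op D A \<Phi> \<sigma>A z h =
     h - \<i> *s \<Phi> (inv_into (L2_on D) (\<lambda>f. A f - z *\<^sub>C f) (adjoint \<Phi> (h v* \<sigma>A)))"

abbreviation ddx :: "real set \<Rightarrow> (real \<Rightarrow> 'a::real_normed_vector) \<Rightarrow> real \<Rightarrow> 'a" where
  "ddx S g x \<equiv> vector_derivative g (at x within S)"

abbreviation differentiable_fun :: "real set \<Rightarrow> (real \<Rightarrow> 'a::real_normed_vector) \<Rightarrow> bool" where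
  "differentiable_fun S g \<equiv> \<forall>x\<in>S. g differentiable (at x within S)"

text \<open>\<open>- y'' + y q = \<mu> y\<close> on \<open>S\<close>, including the existence of \<open>y''\<close>.\<close>

definition sturm_liouville ::
  "real set \<Rightarrow> (real \<Rightarrow> complex^'m^'m) \<Rightarrow> complex \<Rightarrow> (real \<Rightarrow> complex^'m) \<Rightarrow> bool" where
  "sturm_liouville S q \<mu> y \<longleftrightarrow>
     (\<exists>y' y''. \<forall>x\<in>S. (y has_vector_derivative y' x) (at x within S) \<and>
        (y' has_vector_derivative y'' x) (at x within S) \<and>
        - y'' x + y x v* q x = \<mu> *s y x)"

end

(*
  For fixed g in L2_on D, the state equation paired with g reads
  ((A - z) f, g) = (u sigma_A, Phi g).  Differentiating it in x and eliminating f' and A' by the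
  second system equation and the Lax equation, and Phi' by the channel equation, leaves
  (u' sigma_A - i u (z sigma_B + psi), Phi g) = 0; strictness of the colligation makes Phi g
  arbitrary.  The output equation then follows from v = u - i Phi f, the second channel equation
  and the linkage between the two matrices psi.  In components, compatibility is the first order
  system u1' = -u1 L psi12 + i u2, u2' = i (z/b) u1 + i u1 L psi11 + u2 L psi12^*, and
  differentiating it once more gives the Sturm-Liouville equations.

  On the analytic side only the existence of the adjoints of B and Phi is needed.  It is obtained
  explicitly, by Fubini's theorem on the triangle xi <= w, so no completeness of the space L2 is
  required.
*)

theory Submission
  imports Defs
begin

section \<open>Row vectors\<close>

text \<open>The pairing with g is forced by the factor \<open>adjoint (\<Phi> x)\<close> in the
  state equation: the colligation supplies a derivative of \<open>\<Phi>\<close>, not of its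
  adjoint, and after pairing the dependence on x sits in \<open>\<Phi> x g\<close>, which can be
  differentiated.

  Existence of adjoints matters because \<open>adjoint\<close> is a choice: until some map satisfies
  the adjoint identity, nothing is known about \<open>adjoint (B x)\<close> or
  \<open>adjoint (\<Phi> x)\<close>. Once it does, additivity and real homogeneity follow, since
  inner products separate vectors. Complex homogeneity of B and of the model channel is read off the
  integrals, and it passes to adjoints.

  The inner products are real parts of complex ones. Nothing is lost: a vector of
  \<open>complex^'n\<close> is determined by its real pairings with all vectors, and a complex
  factor crosses a pairing as its conjugate.

  The integral part of B is treated as a lower and an upper cumulative integral with arbitrary
  matrix weights. This wider class is closed under adjoints: passing to the adjoint exchanges the
  two weights and conjugate-transposes them.\<close>

lemma vector_matrix_mult_mscale: "x v* (c *\<^sub>M M) = c *s (x v* (M :: complex^'n^'m))"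
  by (simp add: vec_eq_iff vector_matrix_mult_def mscale_def sum_distrib_left mult_ac)

lemma scaleR_vector_matrix_mult: "(a *\<^sub>R x) v* M = a *\<^sub>R (x v* (M :: complex^'n^'m))"
  by (simp add: scaleR_eq_vector_scalar_mult scalar_vector_matrix_assoc)

lemma uminus_vector_matrix_mult: "(- x) v* M = - (x v* (M :: complex^'n^'m))"
  by (simp add: vec_eq_iff vector_matrix_mult_def sum_negf)

lemma vector_matrix_mult_uminus: "x v* (- M) = - (x v* (M :: complex^'n^'m))"
  by (simp add: vec_eq_iff vector_matrix_mult_def sum_negf)

lemma vector_scalar_mult_scaleR: "c *s (a *\<^sub>R x) = a *\<^sub>R (c *s (x :: complex^'n))"
  by (simp add: vec_eq_iff)

lemma bounded_linear_vector_scalar_mult: "bounded_linear (\<lambda>x :: complex^'n. c *s x)"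
  by (intro linear_conv_bounded_linear[THEN iffD1] linearI)
     (simp_all add: vec_eq_iff algebra_simps)

text \<open>For row vectors the factor to be undone stands on the right, so it is the identity
  \<open>M ** matrix_inv M = mat 1\<close> that has to be extracted from the choice in
  \<open>matrix_inv\<close>.\<close>

lemma vector_matrix_inv_mult:
  fixes M :: "complex^'n^'n"
  assumes "invertible M" "x v* M = y"
  shows "x = y v* matrix_inv M"
proof -
  have "M ** matrix_inv M = mat 1"
    using someI_ex[of "\<lambda>M'. M ** M' = mat 1 \<and> M' ** M = mat 1"] assms(1)
    by (simp add: invertible_def matrix_inv_def)
  then show ?thesis
    by (simp add: assms(2)[symmetric] vector_matrix_mul_assoc)
qed

lemma invertible_vector_matrix_mult_cancel:
  fixes M :: "complex^'n^'n"
  shows "invertible M \<Longrightarrow> x v* M = y v* M \<Longrightarrow> x = y"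
  by (metis vector_matrix_inv_mult)

text \<open>The real inner product is the real part of a sesquilinear form, so complex factors cross
  it conjugated. The factors \<open>\<i>\<close> and z are handled in this way later on.\<close>

lemma inner_vector_scalar_mult: "(c *s x) \<bullet> y = x \<bullet> (cnj c *s (y :: complex^'n))"
  by (auto simp: inner_vec_def inner_complex_def algebra_simps intro!: sum.cong)

lemma cadj_cadj [simp]: "cadj (cadj M) = M"
  by (simp add: cadj_def vec_eq_iff)

lemma inner_vector_matrix_mult: "(x v* M) \<bullet> y = x \<bullet> (y v* cadj (M :: complex^'n^'m))"
proof -
  have ci: "a \<bullet> c = Re (a * cnj c)" for a c :: complex
    by (simp add: inner_complex_def)
  have "(x v* M) \<bullet> y = (\<Sum>j\<in>UNIV. \<Sum>i\<in>UNIV. Re (x $ i * M $ i $ j * cnj (y $ j)))"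
    by (simp add: inner_vec_def vector_matrix_mult_def ci sum_distrib_right)
  also have "\<dots> = (\<Sum>i\<in>UNIV. \<Sum>j\<in>UNIV. Re (x $ i * M $ i $ j * cnj (y $ j)))"
    by (rule sum.swap)
  also have "\<dots> = x \<bullet> (y v* cadj M)"
    by (simp add: inner_vec_def vector_matrix_mult_def ci cadj_def sum_distrib_left mult_ac)
  finally show ?thesis .
qed

lemma bounded_bilinear_vector_matrix_mult:
  "bounded_bilinear (\<lambda>(x::complex^'m) (M::complex^'n^'m). x v* M)"
  unfolding bilinear_conv_bounded_bilinear[symmetric] bilinear_def
  by (auto intro!: linearI simp: vec_eq_iff vector_matrix_mult_def sum.distrib algebra_simps
      scaleR_sum_right)

text \<open>Conjugating the entries of M is only real linear, which is all that
  \<open>bounded_bilinear\<close> asks for.\<close>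

lemma bounded_bilinear_vector_cadj_mult:
  "bounded_bilinear (\<lambda>(x::complex^'n) (M::complex^'n^'m). x v* cadj M)"
  unfolding bilinear_conv_bounded_bilinear[symmetric] bilinear_def cadj_def
  by (auto intro!: linearI simp: vec_eq_iff vector_matrix_mult_def sum.distrib algebra_simps
      scaleR_sum_right)

lemmas bounded_linear_vector_matrix_mult =
  bounded_bilinear.bounded_linear_left[OF bounded_bilinear_vector_matrix_mult]

section \<open>Cumulative integrals\<close>

lemma borel_measurable_bilinear:
  fixes f :: "'a \<Rightarrow> 'b::euclidean_space" and g :: "'a \<Rightarrow> 'c::euclidean_space"
    and h :: "'b \<Rightarrow> 'c \<Rightarrow> 'd::real_normed_vector"
  assumes "bounded_bilinear h" "f \<in> borel_measurable M" "g \<in> borel_measurable M"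
  shows "(\<lambda>w. h (f w) (g w)) \<in> borel_measurable M"
  by (rule borel_measurable_continuous_Pair)
     (use assms in \<open>auto intro!: bounded_bilinear.continuous_on[OF assms(1)] continuous_intros\<close>)

text \<open>The crude bound a b \<le> a^2 + b^2 replaces Hoelder's inequality, since integrability
  is wanted and no estimate.\<close>

lemma integrable_bilinear_sq:
  fixes f :: "real \<Rightarrow> 'b::euclidean_space" and g :: "real \<Rightarrow> 'c::euclidean_space"
    and h :: "'b \<Rightarrow> 'c \<Rightarrow> 'd::euclidean_space"
  assumes h: "bounded_bilinear h"
    and "f \<in> borel_measurable lebesgue" "g \<in> borel_measurable lebesgue"
    and "integrable lebesgue (\<lambda>w. (norm (f w))\<^sup>2)" "integrable lebesgue (\<lambda>w. (norm (g w))\<^sup>2)"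
  shows "integrable lebesgue (\<lambda>w. h (f w) (g w))"
proof -
  obtain K where K: "K \<ge> 0" "\<And>a b. norm (h a b) \<le> norm a * norm b * K"
    using bounded_bilinear.nonneg_bounded[OF h] by auto
  have "integrable lebesgue (\<lambda>w. ((norm (f w))\<^sup>2 + (norm (g w))\<^sup>2) * K)"
    using assms by auto
  then show ?thesis
  proof (rule Bochner_Integration.integrable_bound)
    show "AE w in lebesgue. norm (h (f w) (g w)) \<le> norm (((norm (f w))\<^sup>2 + (norm (g w))\<^sup>2) * K)"
    proof (rule AE_I2)
      fix w
      have "norm (f w) * norm (g w) \<le> (norm (f w))\<^sup>2 + (norm (g w))\<^sup>2"
        using sum_squares_bound[of "norm (f w)" "norm (g w)"]
          mult_nonneg_nonneg[OF norm_ge_zero[of "f w"] norm_ge_zero[of "g w"]] by linarith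
      then have "norm (f w) * norm (g w) * K \<le> ((norm (f w))\<^sup>2 + (norm (g w))\<^sup>2) * K"
        using K(1) by (rule mult_right_mono)
      then show "norm (h (f w) (g w)) \<le> norm (((norm (f w))\<^sup>2 + (norm (g w))\<^sup>2) * K)"
        using K order_trans by fastforce
    qed
  qed (rule borel_measurable_bilinear[OF h assms(2,3)])
qed

text \<open>Serves three kinds of products: the cut-off variable w with a function, a cumulative
  integral with the kernel, and a constant row vector with the kernel.\<close>

lemma sq_integrable_bilinear_bounded:
  fixes f :: "real \<Rightarrow> 'b::euclidean_space" and g :: "real \<Rightarrow> 'c::euclidean_space"
    and h :: "'b \<Rightarrow> 'c \<Rightarrow> complex^'p"
  assumes h: "bounded_bilinear h"
    and "f \<in> borel_measurable lebesgue" "g \<in> borel_measurable lebesgue"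
    and "integrable lebesgue (\<lambda>w. (norm (g w))\<^sup>2)" and C: "\<And>w. norm (f w) \<le> C"
  shows "sq_integrable (\<lambda>w. h (f w) (g w))"
proof -
  obtain K where K: "K \<ge> 0" "\<And>a b. norm (h a b) \<le> norm a * norm b * K"
    using bounded_bilinear.nonneg_bounded[OF h] by auto
  note m = borel_measurable_bilinear[OF h assms(2,3)]
  have "integrable lebesgue (\<lambda>w. (norm (g w))\<^sup>2 * (C * K)\<^sup>2)"
    using assms by auto
  then have "integrable lebesgue (\<lambda>w. (norm (h (f w) (g w)))\<^sup>2)"
  proof (rule Bochner_Integration.integrable_bound)
    show "AE w in lebesgue. norm ((norm (h (f w) (g w)))\<^sup>2) \<le> norm ((norm (g w))\<^sup>2 * (C * K)\<^sup>2)"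
    proof (rule AE_I2)
      fix w
      have "norm (h (f w) (g w)) \<le> norm (g w) * (C * K)"
        using K(2)[of "f w" "g w"] mult_right_mono[OF C[of w], of "norm (g w) * K"] K(1)
        by (simp add: mult_ac)
      then have "(norm (h (f w) (g w)))\<^sup>2 \<le> (norm (g w) * (C * K))\<^sup>2"
        by (intro power_mono) auto
      then show "norm ((norm (h (f w) (g w)))\<^sup>2) \<le> norm ((norm (g w))\<^sup>2 * (C * K)\<^sup>2)"
        by (simp add: power_mult_distrib)
    qed
  qed (use m in measurable)
  then show ?thesis using m by (simp add: sq_integrable_def)
qed

text \<open>The measure here is the completion, for which the exhaustion by balls is carried out
  directly; Fubini's theorem is applied to its product with itself.\<close>

lemma sigma_finite_lebesgue: "sigma_finite_measure (lebesgue :: 'a::euclidean_space measure)"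
proof
  show "\<exists>A. countable A \<and> A \<subseteq> sets lebesgue \<and> \<Union>A = space (lebesgue :: 'a measure) \<and>
      (\<forall>a\<in>A. emeasure lebesgue a \<noteq> \<infinity>)"
  proof (intro exI conjI)
    let ?A = "range (\<lambda>n. cball 0 (real n)) :: 'a set set"
    show "\<Union>?A = space lebesgue"
      using real_arch_simple by fastforce
    show "\<forall>a\<in>?A. emeasure lebesgue a \<noteq> \<infinity>"
      using emeasure_lborel_cball_finite by (auto simp: less_top)
  qed auto
qed

lemma pair_sigma_finite_lebesgue:
  "pair_sigma_finite (lebesgue :: real measure) (lebesgue :: real measure)"
  by (intro pair_sigma_finite.intro sigma_finite_lebesgue)

text \<open>The identity is Borel measurable on the completed line, hence so are both coordinates on
  the product, and the triangle is where one is at most the other.\<close>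

lemma measurable_triangle:
  "{p \<in> space (lebesgue \<Otimes>\<^sub>M lebesgue). fst p \<le> (snd p :: real)} \<in> sets (lebesgue \<Otimes>\<^sub>M lebesgue)"
  "{p \<in> space (lebesgue \<Otimes>\<^sub>M lebesgue). snd p \<le> (fst p :: real)} \<in> sets (lebesgue \<Otimes>\<^sub>M lebesgue)"
proof -
  have [measurable]: "(\<lambda>x::real. x) \<in> borel_measurable lebesgue"
    by (simp add: measurable_completion)
  have "(\<lambda>p. (fst p :: real)) \<in> borel_measurable (lebesgue \<Otimes>\<^sub>M lebesgue)"
     "(\<lambda>p. (snd p :: real)) \<in> borel_measurable (lebesgue \<Otimes>\<^sub>M lebesgue)"
    by measurable
  then show "{p \<in> space (lebesgue \<Otimes>\<^sub>M lebesgue). fst p \<le> (snd p :: real)} \<in> sets (lebesgue \<Otimes>\<^sub>M lebesgue)"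
    and "{p \<in> space (lebesgue \<Otimes>\<^sub>M lebesgue). snd p \<le> (fst p :: real)} \<in> sets (lebesgue \<Otimes>\<^sub>M lebesgue)"
    by (auto intro: borel_measurable_le)
qed

lemma integral_triangle_swap:
  fixes F G :: "real \<Rightarrow> 'a::euclidean_space"
  assumes F: "integrable lebesgue F" and G: "integrable lebesgue G"
  shows "(LINT w|lebesgue. (LINT \<xi>:{..w}|lebesgue. F \<xi>) \<bullet> G w)
    = (LINT \<xi>|lebesgue. F \<xi> \<bullet> (LINT w:{\<xi>..}|lebesgue. G w))"
proof -
  interpret pair_sigma_finite "lebesgue :: real measure" "lebesgue :: real measure"
    by (rule pair_sigma_finite_lebesgue)
  \<comment> \<open>One kernel carries both iterated integrals: for fixed \<xi> it is G cut off to
    the half-line above \<xi> (\<open>k1\<close>), for fixed w it is F cut off to the half-line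
    below w (\<open>k2\<close>).\<close>
  let ?k = "\<lambda>\<xi> w. if \<xi> \<le> w then F \<xi> \<bullet> G w else 0"
  have [measurable]: "F \<in> borel_measurable lebesgue" "G \<in> borel_measurable lebesgue"
    using F G by auto
  have k1: "?k \<xi> w = F \<xi> \<bullet> (indicator {\<xi>..} w *\<^sub>R G w)" for \<xi> w
    by (simp add: indicator_def)
  have k2: "?k \<xi> w = (indicator {..w} \<xi> *\<^sub>R F \<xi>) \<bullet> G w" for \<xi> w
    by (simp add: indicator_def)
  have iG: "integrable lebesgue (\<lambda>w. indicator {\<xi>..} w *\<^sub>R G w)" for \<xi>
    by (rule integrable_mult_indicator) (use G in auto)
  have iF: "integrable lebesgue (\<lambda>\<xi>. indicator {..w} \<xi> *\<^sub>R F \<xi>)" for w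
    by (rule integrable_mult_indicator) (use F in auto)
  have int: "integrable (lebesgue \<Otimes>\<^sub>M lebesgue) (case_prod ?k)"
  proof (rule Fubini_integrable)
    have "(\<lambda>p. if fst p \<le> snd p then F (fst p) \<bullet> G (snd p) else 0)
        \<in> borel_measurable (lebesgue \<Otimes>\<^sub>M lebesgue)"
      by (rule measurable_If) (use measurable_triangle in measurable)
    then show m: "case_prod ?k \<in> borel_measurable (lebesgue \<Otimes>\<^sub>M lebesgue)"
      by (simp add: case_prod_beta')
    show "AE \<xi> in lebesgue. integrable lebesgue (\<lambda>w. case (\<xi>, w) of (\<xi>, w) \<Rightarrow> ?k \<xi> w)"
      using iG by (auto simp only: k1 prod.case intro!: integrable_inner_right)
    \<comment> \<open>By Cauchy-Schwarz the inner integral of the absolute kernel is at most |F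
      \<xi>| times the L1 norm of G.\<close>
    have int: "integrable lebesgue (\<lambda>\<xi>. norm (F \<xi>) * (LINT w|lebesgue. norm (G w)))"
      using F by auto
    show "integrable lebesgue
        (\<lambda>\<xi>. LINT w|lebesgue. norm (case (\<xi>, w) of (\<xi>, w) \<Rightarrow> ?k \<xi> w))"
    proof (rule Bochner_Integration.integrable_bound[OF int])
      show "(\<lambda>\<xi>. LINT w|lebesgue. norm (case (\<xi>, w) of (\<xi>, w) \<Rightarrow> ?k \<xi> w))
          \<in> borel_measurable lebesgue"
        by (rule sigma_finite_measure.borel_measurable_lebesgue_integral[OF sigma_finite_lebesgue])
          (use m in measurable)
      show "AE \<xi> in lebesgue. norm (LINT w|lebesgue. norm (case (\<xi>, w) of (\<xi>, w) \<Rightarrow> ?k \<xi> w))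
          \<le> norm (norm (F \<xi>) * (LINT w|lebesgue. norm (G w)))"
      proof (rule AE_I2)
        fix \<xi>
        have "(LINT w|lebesgue. norm (?k \<xi> w)) \<le> (LINT w|lebesgue. norm (F \<xi>) * norm (G w))"
        proof (rule integral_mono)
          show "integrable lebesgue (\<lambda>w. norm (?k \<xi> w))"
            unfolding k1 by (intro integrable_norm integrable_inner_right iG)
          show "integrable lebesgue (\<lambda>w. norm (F \<xi>) * norm (G w))"
            using G by auto
          show "norm (?k \<xi> w) \<le> norm (F \<xi>) * norm (G w)" for w
            by (auto simp: Cauchy_Schwarz_ineq2)
        qed
        then show "norm (LINT w|lebesgue. norm (case (\<xi>, w) of (\<xi>, w) \<Rightarrow> ?k \<xi> w))
          \<le> norm (norm (F \<xi>) * (LINT w|lebesgue. norm (G w)))"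
          by simp
      qed
    qed
  qed
  have "(LINT w|lebesgue. (LINT \<xi>:{..w}|lebesgue. F \<xi>) \<bullet> G w)
      = (LINT w|lebesgue. LINT \<xi>|lebesgue. ?k \<xi> w)"
    unfolding k2 set_lebesgue_integral_def using iF
    by (intro Bochner_Integration.integral_cong refl integral_inner_left[symmetric]) auto
  also have "\<dots> = (LINT \<xi>|lebesgue. LINT w|lebesgue. ?k \<xi> w)"
    by (rule Fubini_integral[OF int])
  also have "\<dots> = (LINT \<xi>|lebesgue. F \<xi> \<bullet> (LINT w:{\<xi>..}|lebesgue. G w))"
    unfolding k1 set_lebesgue_integral_def using iG
    by (intro Bochner_Integration.integral_cong refl integral_inner_right) auto
  finally show ?thesis .
qed

text \<open>These are parameter integrals of a jointly measurable function on a triangle, so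
  measurability in the endpoint comes from the product measure.\<close>

lemma measurable_cumulative_integral:
  fixes F :: "real \<Rightarrow> 'a::euclidean_space"
  assumes F: "integrable lebesgue F"
  shows "(\<lambda>w. LINT \<xi>:{..w}|lebesgue. F \<xi>) \<in> borel_measurable lebesgue"
    and "(\<lambda>w. LINT \<xi>:{w..}|lebesgue. F \<xi>) \<in> borel_measurable lebesgue"
proof -
  interpret pair_sigma_finite "lebesgue :: real measure" "lebesgue :: real measure"
    by (rule pair_sigma_finite_lebesgue)
  have [measurable]: "F \<in> borel_measurable lebesgue"
    using F by auto
  have "(\<lambda>p. if snd p \<le> fst p then F (snd p) else 0) \<in> borel_measurable (lebesgue \<Otimes>\<^sub>M lebesgue)"
    by (rule measurable_If) (use measurable_triangle in measurable)
  then have "(\<lambda>w. LINT \<xi>|lebesgue. (if \<xi> \<le> w then F \<xi> else 0)) \<in> borel_measurable lebesgue"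
    by (intro sigma_finite_measure.borel_measurable_lebesgue_integral[OF sigma_finite_lebesgue])
       (simp add: case_prod_beta')
  moreover have "indicator {..w} \<xi> *\<^sub>R F \<xi> = (if \<xi> \<le> w then F \<xi> else 0)" for w \<xi>
    by (simp add: indicator_def)
  ultimately show "(\<lambda>w. LINT \<xi>:{..w}|lebesgue. F \<xi>) \<in> borel_measurable lebesgue"
    by (simp add: set_lebesgue_integral_def)
  have "(\<lambda>p. if fst p \<le> snd p then F (snd p) else 0) \<in> borel_measurable (lebesgue \<Otimes>\<^sub>M lebesgue)"
    by (rule measurable_If) (use measurable_triangle in measurable)
  then have "(\<lambda>w. LINT \<xi>|lebesgue. (if w \<le> \<xi> then F \<xi> else 0)) \<in> borel_measurable lebesgue"
    by (intro sigma_finite_measure.borel_measurable_lebesgue_integral[OF sigma_finite_lebesgue])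
       (simp add: case_prod_beta')
  moreover have "indicator {w..} \<xi> *\<^sub>R F \<xi> = (if w \<le> \<xi> then F \<xi> else 0)" for w \<xi>
    by (simp add: indicator_def)
  ultimately show "(\<lambda>w. LINT \<xi>:{w..}|lebesgue. F \<xi>) \<in> borel_measurable lebesgue"
    by (simp add: set_lebesgue_integral_def)
qed

text \<open>The bound is uniform in A, so cumulative integrals are bounded functions of their
  endpoint.\<close>

lemma norm_set_integral_le:
  fixes F :: "real \<Rightarrow> 'a::euclidean_space"
  assumes F: "integrable lebesgue F" and "A \<in> sets lebesgue"
  shows "norm (LINT \<xi>:A|lebesgue. F \<xi>) \<le> (LINT \<xi>|lebesgue. norm (F \<xi>))"
proof -
  have i: "integrable lebesgue (\<lambda>\<xi>. indicator A \<xi> *\<^sub>R F \<xi>)"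
    by (rule integrable_mult_indicator) (use assms in auto)
  have "norm (LINT \<xi>:A|lebesgue. F \<xi>) \<le> (LINT \<xi>|lebesgue. norm (indicator A \<xi> *\<^sub>R F \<xi>))"
    unfolding set_lebesgue_integral_def by (rule integral_norm_bound)
  also have "\<dots> \<le> (LINT \<xi>|lebesgue. norm (F \<xi>))"
    by (rule integral_mono[OF integrable_norm[OF i] integrable_norm[OF F]]) (simp add: indicator_def)
  finally show ?thesis .
qed

section \<open>Adjoints of the triangular model\<close>

lemma sq_integrable_rep_L2: "sq_integrable (rep_L2 f)"
  using Quotient3_rep_reflp[OF Quotient3_L2, of f] by (simp add: L2_rel_def)

lemma abs_rep_L2: "abs_L2 (rep_L2 f) = f"
  by (rule Quotient3_abs_rep[OF Quotient3_L2])

lemma rep_abs_L2: "sq_integrable h \<Longrightarrow> AE w in lebesgue. rep_L2 (abs_L2 h) w = h w"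
  using rep_abs_rsp_left[OF Quotient3_L2, of h h] by (simp add: L2_rel_def)

lemma inner_abs_L2:
  assumes "sq_integrable h"
  shows "abs_L2 h \<bullet> g = (LINT w|lebesgue. h w \<bullet> rep_L2 g w)"
proof -
  have "abs_L2 h \<bullet> abs_L2 (rep_L2 g) = (LINT w|lebesgue. h w \<bullet> rep_L2 g w)"
    by (rule inner_L2.abs_eq) (use assms sq_integrable_rep_L2 in \<open>auto simp: L2_rel_def\<close>)
  then show ?thesis by (simp add: abs_rep_L2)
qed

lemma inner_abs_L2_right:
  "sq_integrable h \<Longrightarrow> g \<bullet> abs_L2 h = (LINT w|lebesgue. rep_L2 g w \<bullet> h w)"
  using inner_abs_L2[of h g] by (simp add: inner_commute[of g] inner_commute[of "rep_L2 g _"])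

lemma scaleC_abs_L2: "sq_integrable h \<Longrightarrow> c *\<^sub>C abs_L2 h = abs_L2 (\<lambda>w. c *s h w)"
  by (rule scaleC_L2.abs_eq) (simp add: L2_rel_def)

lemma rep_scaleC_L2: "AE w in lebesgue. rep_L2 (c *\<^sub>C f) w = c *s rep_L2 f w"
  using rep_abs_L2[OF sq_integrable_scale[OF sq_integrable_rep_L2[of f], of c]]
  by (simp add: scaleC_abs_L2[OF sq_integrable_rep_L2, symmetric] abs_rep_L2)

definition sq_integrable_kernel :: "(real \<Rightarrow> complex^'m^'p) \<Rightarrow> bool" where
  "sq_integrable_kernel Q \<longleftrightarrow>
     Q \<in> borel_measurable lebesgue \<and> integrable lebesgue (\<lambda>w. (norm (Q w))\<^sup>2)"

lemma integrable_vector_kernel_mult: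
  "sq_integrable f \<Longrightarrow> sq_integrable_kernel Q \<Longrightarrow> integrable lebesgue (\<lambda>w. f w v* Q w)"
  unfolding sq_integrable_def sq_integrable_kernel_def
  by (intro integrable_bilinear_sq[OF bounded_bilinear_vector_matrix_mult]) auto

text \<open>
  Below \<open>Q\<close> is \<open>\<Pi>\<close> extended by zero outside \<open>[-l, l]\<close>, so that integration over half-lines suffices.
\<close>

definition tri_fun ::
  "(real \<Rightarrow> complex^'m^'p) \<Rightarrow> complex^'m^'m \<Rightarrow> complex^'m^'m
    \<Rightarrow> (real \<Rightarrow> complex^'p) \<Rightarrow> real \<Rightarrow> complex^'p" where
  "tri_fun Q M1 M2 f w =
     ((LINT \<xi>:{..w}|lebesgue. f \<xi> v* Q \<xi>) v* M1 + (LINT \<xi>:{w..}|lebesgue. f \<xi> v* Q \<xi>) v* M2)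
       v* cadj (Q w)"

text \<open>The bracket in \<open>tri_fun\<close> is bounded in w by a multiple of the L1 norm of f
  Q, and the remaining factor \<open>cadj (Q w)\<close> is square-integrable.\<close>

lemma sq_integrable_tri_fun:
  fixes Q :: "real \<Rightarrow> complex^'m^'p"
  assumes f: "sq_integrable f" and Q: "sq_integrable_kernel Q"
  shows "sq_integrable (tri_fun Q M1 M2 f)"
proof -
  let ?F = "\<lambda>w. f w v* Q w"
  note F = integrable_vector_kernel_mult[OF f Q]
  obtain K1 where K1: "K1 > 0" "\<And>x. norm (x v* M1) \<le> norm x * K1"
    using bounded_linear.pos_bounded[OF bounded_linear_vector_matrix_mult[of M1]] by auto
  obtain K2 where K2: "K2 > 0" "\<And>x. norm (x v* M2) \<le> norm x * K2"
    using bounded_linear.pos_bounded[OF bounded_linear_vector_matrix_mult[of M2]] by auto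
  let ?I = "LINT \<xi>|lebesgue. norm (?F \<xi>)"
  let ?x = "\<lambda>w. (LINT \<xi>:{..w}|lebesgue. ?F \<xi>) v* M1 + (LINT \<xi>:{w..}|lebesgue. ?F \<xi>) v* M2"
  have m: "?x \<in> borel_measurable lebesgue"
    using measurable_cumulative_integral[OF F]
    by (intro borel_measurable_add borel_measurable_bilinear[OF bounded_bilinear_vector_matrix_mult]) auto
  have "norm (?x w) \<le> ?I * K1 + ?I * K2" for w
  proof -
    have "norm (?x w) \<le> norm ((LINT \<xi>:{..w}|lebesgue. ?F \<xi>) v* M1)
        + norm ((LINT \<xi>:{w..}|lebesgue. ?F \<xi>) v* M2)"
      by (rule norm_triangle_ineq)
    also have "\<dots> \<le> norm (LINT \<xi>:{..w}|lebesgue. ?F \<xi>) * K1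
        + norm (LINT \<xi>:{w..}|lebesgue. ?F \<xi>) * K2"
      by (intro add_mono K1 K2)
    also have "\<dots> \<le> ?I * K1 + ?I * K2"
      by (intro add_mono mult_right_mono norm_set_integral_le F) (use K1 K2 in auto)
    finally show ?thesis .
  qed
  then have "sq_integrable (\<lambda>w. ?x w v* cadj (Q w))"
    using Q m unfolding sq_integrable_kernel_def
    by (intro sq_integrable_bilinear_bounded[OF bounded_bilinear_vector_cadj_mult]) auto
  then show ?thesis by (simp add: tri_fun_def[abs_def])
qed

lemma set_integral_vector_matrix_mult:
  assumes "integrable lebesgue F" "A \<in> sets lebesgue"
  shows "(LINT \<xi>:A|lebesgue. F \<xi> v* M) = (LINT \<xi>:A|lebesgue. F \<xi>) v* (M :: complex^'n^'m)"
proof -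
  have i: "integrable lebesgue (\<lambda>\<xi>. indicator A \<xi> *\<^sub>R F \<xi>)"
    by (rule integrable_mult_indicator) (use assms in auto)
  show ?thesis
    using integral_bounded_linear[OF bounded_linear_vector_matrix_mult i, of M]
    by (simp add: set_lebesgue_integral_def scaleR_vector_matrix_mult)
qed

text \<open>Exchanging the order of integration turns an integral up to w into one from w on. Hence
  M1 and M2 change places besides being conjugate-transposed.\<close>

lemma tri_fun_inner:
  fixes Q :: "real \<Rightarrow> complex^'m^'p"
  assumes f: "sq_integrable f" and g: "sq_integrable g" and Q: "sq_integrable_kernel Q"
  shows "(LINT w|lebesgue. tri_fun Q M1 M2 f w \<bullet> g w)
    = (LINT w|lebesgue. f w \<bullet> tri_fun Q (cadj M2) (cadj M1) g w)"
proof -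
  let ?F = "\<lambda>w. f w v* Q w" and ?G = "\<lambda>w. g w v* Q w"
  let ?l = "\<lambda>H w. LINT \<xi>:{..w}|lebesgue. H \<xi>" and ?u = "\<lambda>H w. LINT \<xi>:{w..}|lebesgue. H \<xi>"
  note F = integrable_vector_kernel_mult[OF f Q] and G = integrable_vector_kernel_mult[OF g Q]
  have GM: "integrable lebesgue (\<lambda>w. ?G w v* M)" for M
    by (rule integrable_bounded_linear[OF bounded_linear_vector_matrix_mult G])
  have split: "tri_fun Q M1 M2 f w \<bullet> g w = ?l ?F w \<bullet> (?G w v* cadj M1) + ?u ?F w \<bullet> (?G w v* cadj M2)" for w
    by (simp add: tri_fun_def inner_vector_matrix_mult inner_add_left vector_matrix_left_distrib)
  have split': "f w \<bullet> tri_fun Q (cadj M2) (cadj M1) g w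
      = ?F w \<bullet> ?u (\<lambda>w. ?G w v* cadj M1) w + ?F w \<bullet> ?l (\<lambda>w. ?G w v* cadj M2) w" for w
    by (simp add: tri_fun_def inner_vector_matrix_mult inner_add_right
        vector_matrix_left_distrib set_integral_vector_matrix_mult[OF G])
  \<comment> \<open>Licenses splitting the integral of the sum: each summand is a bounded cumulative
    integral paired with an integrable function.\<close>
  have bnd: "integrable lebesgue (\<lambda>w. X w \<bullet> H w)"
    if "X \<in> borel_measurable lebesgue" "\<And>w. norm (X w) \<le> C" "integrable lebesgue H"
    for X H :: "real \<Rightarrow> complex^'m" and C
  proof (rule Bochner_Integration.integrable_bound)
    show "integrable lebesgue (\<lambda>w. C * norm (H w))"
      using that by auto
    show "AE w in lebesgue. norm (X w \<bullet> H w) \<le> norm (C * norm (H w))"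
    proof (rule AE_I2)
      fix w
      have "norm (X w \<bullet> H w) \<le> norm (X w) * norm (H w)"
        by (simp add: Cauchy_Schwarz_ineq2)
      also have "\<dots> \<le> C * norm (H w)"
        by (intro mult_right_mono that) auto
      finally show "norm (X w \<bullet> H w) \<le> norm (C * norm (H w))"
        by simp
    qed
  qed (use that in \<open>auto intro!: borel_measurable_inner\<close>)
  have li: "integrable lebesgue (\<lambda>w. ?l X w \<bullet> H w)" and ui: "integrable lebesgue (\<lambda>w. ?u X w \<bullet> H w)"
    if "integrable lebesgue X" "integrable lebesgue H" for X H :: "real \<Rightarrow> complex^'m"
    by (intro bnd[OF _ norm_set_integral_le] measurable_cumulative_integral that; simp)+
  have "(LINT w|lebesgue. tri_fun Q M1 M2 f w \<bullet> g w)
      = (LINT w|lebesgue. ?l ?F w \<bullet> (?G w v* cadj M1))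
      + (LINT w|lebesgue. ?u ?F w \<bullet> (?G w v* cadj M2))"
    unfolding split by (intro Bochner_Integration.integral_add li ui F GM)
  also have "(LINT w|lebesgue. ?l ?F w \<bullet> (?G w v* cadj M1))
      = (LINT w|lebesgue. ?F w \<bullet> ?u (\<lambda>w. ?G w v* cadj M1) w)"
    by (rule integral_triangle_swap[OF F GM])
  \<comment> \<open>The upper integral is the same triangle identity read backwards, with G in the
    role of F.\<close>
  also have "(LINT w|lebesgue. ?u ?F w \<bullet> (?G w v* cadj M2))
      = (LINT w|lebesgue. ?F w \<bullet> ?l (\<lambda>w. ?G w v* cadj M2) w)"
    using integral_triangle_swap[OF GM F, of "cadj M2"] by (simp add: inner_commute)
  also have "(LINT w|lebesgue. ?F w \<bullet> ?u (\<lambda>w. ?G w v* cadj M1) w)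
      + (LINT w|lebesgue. ?F w \<bullet> ?l (\<lambda>w. ?G w v* cadj M2) w)
    = (LINT w|lebesgue. f w \<bullet> tri_fun Q (cadj M2) (cadj M1) g w)"
    unfolding split' using li[OF GM F] ui[OF GM F]
    by (intro Bochner_Integration.integral_add[symmetric]) (simp_all add: inner_commute)
  finally show ?thesis .
qed

text \<open>f enters \<open>tri_fun\<close> through integrals only, so agreement almost everywhere
  gives equality at every point. This matters because the representative of
  \<open>c *\<^sub>C f\<close> is known only almost everywhere.\<close>

lemma tri_fun_cong_AE:
  assumes f: "sq_integrable f" and g: "sq_integrable g" and Q: "sq_integrable_kernel Q"
    and eq: "AE w in lebesgue. f w = g w"
  shows "tri_fun Q M1 M2 f = tri_fun Q M1 M2 g"
proof -
  have *: "(LINT \<xi>:A|lebesgue. f \<xi> v* Q \<xi>) = (LINT \<xi>:A|lebesgue. g \<xi> v* Q \<xi>)"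
    if "A \<in> sets lebesgue" for A
    unfolding set_lebesgue_integral_def
  proof (rule integral_cong_AE)
    show "AE \<xi> in lebesgue. indicator A \<xi> *\<^sub>R (f \<xi> v* Q \<xi>) = indicator A \<xi> *\<^sub>R (g \<xi> v* Q \<xi>)"
      using eq by eventually_elim simp
  qed (use integrable_vector_kernel_mult[OF f Q] integrable_vector_kernel_mult[OF g Q] that in
        \<open>auto intro!: borel_measurable_integrable integrable_mult_indicator\<close>)
  show ?thesis
    by (intro ext) (simp add: tri_fun_def *)
qed

lemma tri_fun_scale:
  assumes f: "sq_integrable f" and Q: "sq_integrable_kernel Q"
  shows "tri_fun Q M1 M2 (\<lambda>w. c *s f w) w = c *s tri_fun Q M1 M2 f w"
proof -
  have *: "(LINT \<xi>:A|lebesgue. (c *s f \<xi>) v* Q \<xi>) = c *s (LINT \<xi>:A|lebesgue. f \<xi> v* Q \<xi>)"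
    if "A \<in> sets lebesgue" for A
  proof -
    have i: "integrable lebesgue (\<lambda>\<xi>. indicator A \<xi> *\<^sub>R (f \<xi> v* Q \<xi>))"
      by (rule integrable_mult_indicator) (use that integrable_vector_kernel_mult[OF f Q] in auto)
    show ?thesis
      using integral_bounded_linear[OF bounded_linear_vector_scalar_mult i, of c]
      by (simp add: set_lebesgue_integral_def scalar_vector_matrix_assoc vector_scalar_mult_scaleR)
  qed
  have A: "{..w} \<in> sets lebesgue" "{w..} \<in> sets lebesgue"
    by auto
  show ?thesis
    unfolding tri_fun_def *[OF A(1)] *[OF A(2)]
    by (simp only: scalar_vector_matrix_assoc vector_add_ldistrib[symmetric])
qed

text \<open>The shape of B with free weights M1 and M2. With this freedom the adjoint has the same
  shape, whereas the special weights of B are not preserved.\<close>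

definition tri_op ::
  "real \<Rightarrow> (real \<Rightarrow> complex^'m^'p) \<Rightarrow> complex^'m^'m \<Rightarrow> complex^'m^'m
    \<Rightarrow> ('p::finite) L2 \<Rightarrow> 'p L2" where
  "tri_op l Q M1 M2 f =
     abs_L2 (\<lambda>w. (indicator {-l..l} w * w) *\<^sub>R rep_L2 f w + tri_fun Q M1 M2 (rep_L2 f) w)"

lemma sq_integrable_cutoff: 
  assumes "sq_integrable f"
  shows "sq_integrable (\<lambda>w. (indicator {-l..l} w * w) *\<^sub>R f w)"
proof (rule sq_integrable_bilinear_bounded[OF bounded_bilinear_scaleR])
  show "(\<lambda>w::real. indicator {-l..l} w * w :: real) \<in> borel_measurable lebesgue"
    by (rule measurable_completion) auto
  show "norm (indicator {-l..l} w * w :: real) \<le> \<bar>l\<bar>" for w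
    by (auto simp: indicator_def)
qed (use assms in \<open>auto simp: sq_integrable_def\<close>)

text \<open>The multiplier is real, so the multiplication part is symmetric; only the integral part
  changes.\<close>

lemma tri_op_adjoint:
  assumes Q: "sq_integrable_kernel Q"
  shows "tri_op l Q M1 M2 f \<bullet> g = f \<bullet> tri_op l Q (cadj M2) (cadj M1) g"
proof -
  let ?c = "\<lambda>f w. (indicator {-l..l} w * w) *\<^sub>R rep_L2 f w"
  note sq = sq_integrable_rep_L2 sq_integrable_tri_fun[OF sq_integrable_rep_L2 Q]
    sq_integrable_cutoff[OF sq_integrable_rep_L2] 
  have "tri_op l Q M1 M2 f \<bullet> g
      = (LINT w|lebesgue. ?c f w \<bullet> rep_L2 g w + tri_fun Q M1 M2 (rep_L2 f) w \<bullet> rep_L2 g w)"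
    unfolding tri_op_def
    by (subst inner_abs_L2) (auto intro!: sq_integrable_add sq simp: inner_add_left)
  also have "\<dots> = (LINT w|lebesgue. ?c f w \<bullet> rep_L2 g w)
      + (LINT w|lebesgue. tri_fun Q M1 M2 (rep_L2 f) w \<bullet> rep_L2 g w)"
    by (intro Bochner_Integration.integral_add sq_integrable_inner sq)
  also have "\<dots> = (LINT w|lebesgue. rep_L2 f w \<bullet> ?c g w)
      + (LINT w|lebesgue. rep_L2 f w \<bullet> tri_fun Q (cadj M2) (cadj M1) (rep_L2 g) w)"
    by (simp add: tri_fun_inner[OF sq_integrable_rep_L2 sq_integrable_rep_L2 Q])
  also have "\<dots> = (LINT w|lebesgue. rep_L2 f w \<bullet> ?c g w
      + rep_L2 f w \<bullet> tri_fun Q (cadj M2) (cadj M1) (rep_L2 g) w)"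
    by (intro Bochner_Integration.integral_add[symmetric] sq_integrable_inner sq)
  also have "\<dots> = f \<bullet> tri_op l Q (cadj M2) (cadj M1) g"
    unfolding tri_op_def
    by (subst inner_abs_L2_right) (auto intro!: sq_integrable_add sq simp: inner_add_right)
  finally show ?thesis .
qed

lemma tri_op_scaleC:
  assumes Q: "sq_integrable_kernel Q"
  shows "tri_op l Q M1 M2 (c *\<^sub>C f) = c *\<^sub>C tri_op l Q M1 M2 f"
proof -
  let ?h = "\<lambda>f w. (indicator {-l..l} w * w) *\<^sub>R f w + tri_fun Q M1 M2 f w"
  let ?f = "rep_L2 f" and ?cf = "rep_L2 (c *\<^sub>C f)"
  note sq = sq_integrable_rep_L2 sq_integrable_tri_fun[OF sq_integrable_rep_L2 Q]
    sq_integrable_cutoff[OF sq_integrable_rep_L2] sq_integrable_add sq_integrable_scale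
  have "tri_fun Q M1 M2 ?cf = tri_fun Q M1 M2 (\<lambda>w. c *s ?f w)"
    by (rule tri_fun_cong_AE) (intro sq Q rep_scaleC_L2)+
  also have "\<dots> = (\<lambda>w. c *s tri_fun Q M1 M2 ?f w)"
    by (intro ext tri_fun_scale sq Q)
  finally have t: "tri_fun Q M1 M2 ?cf = (\<lambda>w. c *s tri_fun Q M1 M2 ?f w)" .
  have "L2_rel (?h ?cf) (\<lambda>w. c *s ?h ?f w)"
    unfolding L2_rel_def
  proof (intro conjI sq)
    show "AE w in lebesgue. ?h ?cf w = c *s ?h ?f w"
      using rep_scaleC_L2[of c f]
      by eventually_elim (simp add: t vector_add_ldistrib vector_scalar_mult_scaleR)
  qed
  then have "abs_L2 (?h ?cf) = abs_L2 (\<lambda>w. c *s ?h ?f w)"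
    by (rule Quotient3_rel_abs[OF Quotient3_L2])
  also have "\<dots> = c *\<^sub>C abs_L2 (?h ?f)"
    by (rule scaleC_abs_L2[symmetric]) (intro sq)
  finally show ?thesis by (simp add: tri_op_def)
qed

section \<open>The triangular model as a triangular integral operator\<close>

lemma norm_eq_trace: "(norm M)\<^sup>2 = Re (trace (cadj M ** (M :: complex^'m^'p)))"
proof -
  have "(norm M)\<^sup>2 = (\<Sum>i\<in>UNIV. \<Sum>j\<in>UNIV. (cmod (M $ i $ j))\<^sup>2)"
    by (simp add: norm_vec_def L2_set_def sum_nonneg)
  also have "\<dots> = (\<Sum>j\<in>UNIV. \<Sum>i\<in>UNIV. (cmod (M $ i $ j))\<^sup>2)"
    by (rule sum.swap)
  also have "\<dots> = (\<Sum>j\<in>UNIV. \<Sum>i\<in>UNIV. Re (cnj (M $ i $ j) * M $ i $ j))"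
    unfolding cmod_power2 by (simp add: power2_eq_square)
  also have "\<dots> = Re (trace (cadj M ** M))"
    by (simp add: trace_def matrix_matrix_mult_def cadj_def)
  finally show ?thesis .
qed

text \<open>The matrix norm is the Frobenius norm, so the trace normalisation says that P has norm 1
  at every point of the interval. The squared norm of the extended kernel is therefore the indicator
  of a bounded interval.\<close>

lemma triangular_model_kernel:
  fixes P :: "real \<Rightarrow> complex^('m::{finite,linorder})^('p::finite)"
  assumes "triangular_model_data l r L S0 P"
  shows "sq_integrable_kernel (\<lambda>w. if w \<in> {-l..l} then P w else 0)" (is "sq_integrable_kernel ?Q")
proof -
  have P: "P \<in> borel_measurable (lebesgue_on {-l..l})"
    and tr: "\<And>w. w \<in> {-l..l} \<Longrightarrow> trace (cadj (P w) ** P w) = 1"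
    using assms by (auto simp: triangular_model_data_def)
  have m: "?Q \<in> borel_measurable lebesgue"
    by (rule borel_measurable_if_I[OF P]) auto
  have "(norm (?Q w))\<^sup>2 = indicator {-l..l} w" for w
    using tr[of w] by (cases "w \<in> {-l..l}") (auto simp: norm_eq_trace[of "P w"])
  moreover have "integrable lebesgue (indicator {-l..l} :: real \<Rightarrow> real)"
    by (rule integrable_real_indicator) (auto simp: emeasure_lborel_Icc_eq)
  ultimately have "integrable lebesgue (\<lambda>w. (norm (?Q w))\<^sup>2)"
    by presburger
  then show ?thesis
    using m by (simp add: sq_integrable_kernel_def)
qed

lemma triangular_op_eq_tri_op:
  fixes P :: "real \<Rightarrow> complex^('m::{finite,linorder})^('p::finite)"
  assumes "triangular_model_data l r L S0 P"
  shows "triangular_op l L S0 P = tri_op l (\<lambda>w. if w \<in> {-l..l} then P w else 0)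
     ((- \<i>) *\<^sub>M cadj S0 + \<i> *\<^sub>M L) (\<i> *\<^sub>M S0)" (is "_ = tri_op l ?Q _ _")
proof
  fix f :: "'p L2"
  note Q = triangular_model_kernel[OF assms]
  let ?f = "rep_L2 f"
  let ?F = "\<lambda>w. ?f w v* ?Q w"
  have F: "integrable lebesgue ?F"
    by (intro integrable_vector_kernel_mult Q sq_integrable_rep_L2)
  \<comment> \<open>The weight and \<open>cadj (P w)\<close> do not depend on the integration
    variable and leave the integral as one matrix; the cut-off of P absorbs the finite
    endpoint.\<close>
  have K: "(LINT \<xi>:A|lebesgue. ?f \<xi> v* P \<xi> v* K v* cadj (P w))
      = (LINT \<xi>:A'|lebesgue. ?F \<xi>) v* K v* cadj (P w)"
    if w: "w \<in> {-l..l}" and A: "A' \<in> sets lebesgue" "A = A' \<inter> {-l..l}" for w A A' K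
  proof -
    have "(LINT \<xi>:A|lebesgue. ?f \<xi> v* P \<xi> v* K v* cadj (P w))
        = (LINT \<xi>:A'|lebesgue. ?F \<xi> v* (K ** cadj (P w)))"
      unfolding set_lebesgue_integral_def
      by (rule Bochner_Integration.integral_cong)
         (auto simp: A indicator_def vector_matrix_mul_assoc matrix_mul_assoc)
    also have "\<dots> = (LINT \<xi>:A'|lebesgue. ?F \<xi>) v* (K ** cadj (P w))"
      by (rule set_integral_vector_matrix_mult[OF F A(1)])
    also have "\<dots> = (LINT \<xi>:A'|lebesgue. ?F \<xi>) v* K v* cadj (P w)"
      by (rule vector_matrix_mul_assoc[symmetric])
    finally show ?thesis .
  qed
  have "(if w \<in> {-l..l} then triangular_fun l L S0 P ?f w else 0)
     = (indicator {-l..l} w * w) *\<^sub>R ?f w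
       + tri_fun ?Q ((- \<i>) *\<^sub>M cadj S0 + \<i> *\<^sub>M L) (\<i> *\<^sub>M S0) ?f w" for w
  proof (cases "w \<in> {-l..l}")
    case True
    have lo: "{-l..w} = {..w} \<inter> {-l..l}" and up: "{w..l} = {w..} \<inter> {-l..l}"
      using True by auto
    show ?thesis
      using True
      unfolding triangular_fun_def tri_fun_def
      by (simp add: K[OF True _ lo] K[OF True _ up] vector_matrix_mult_add_rdistrib
          vector_matrix_left_distrib vector_matrix_mult_mscale
          scalar_vector_matrix_assoc scaleR_eq_vector_scalar_mult algebra_simps del: atLeastAtMost_iff)
  next
    case False
    \<comment> \<open>Outside the interval the last factor of \<open>tri_fun\<close> vanishes, which
      matches the value 0 prescribed there.\<close>
    then have "cadj (?Q w) = 0"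
      by (auto simp: cadj_def vec_eq_iff)
    then show ?thesis
      using False by (auto simp: tri_fun_def)
  qed
  then show "triangular_op l L S0 P f = tri_op l ?Q ((- \<i>) *\<^sub>M cadj S0 + \<i> *\<^sub>M L) (\<i> *\<^sub>M S0) f"
    by (simp add: triangular_op_def tri_op_def)
qed

text \<open>\<open>tri_op_adjoint\<close> supplies a witness for the adjoint identity, and
  \<open>adjoint_unique\<close> shows that the chosen adjoint is this witness.\<close>

lemma triangular_op_adjoint:
  assumes "triangular_model_data l r L S0 P"
  shows "triangular_op l L S0 P f \<bullet> g = f \<bullet> adjoint (triangular_op l L S0 P) g"
proof -
  note Q = triangular_model_kernel[OF assms]
  show ?thesis
    unfolding triangular_op_eq_tri_op[OF assms]
    using tri_op_adjoint[OF Q] by (subst adjoint_unique) auto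
qed

lemma triangular_op_scaleC:
  "triangular_model_data l r L S0 P
    \<Longrightarrow> triangular_op l L S0 P (c *\<^sub>C f) = c *\<^sub>C triangular_op l L S0 P f"
  by (simp only: triangular_op_eq_tri_op tri_op_scaleC[OF triangular_model_kernel])

section \<open>The channel operator of the model\<close>

lemma model_channel_eq:
  "model_channel l P f = (LINT w|lebesgue. rep_L2 f w v* (if w \<in> {-l..l} then P w else 0))"
  unfolding model_channel_def set_lebesgue_integral_def
  by (rule Bochner_Integration.integral_cong) (auto simp: indicator_def)

text \<open>The adjoint sends h to the function h P(w)^* on the interval; it is square-integrable as
  a constant row vector times a square-integrable kernel.\<close>

lemma model_channel_adjoint:
  fixes P :: "real \<Rightarrow> complex^('m::{finite,linorder})^('p::finite)"
  assumes "triangular_model_data l r L S0 P"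
  shows "\<exists>T. \<forall>f h. model_channel l P f \<bullet> h = f \<bullet> T h"
proof -
  let ?Q = "\<lambda>w. if w \<in> {-l..l} then P w else 0"
  note Q = triangular_model_kernel[OF assms]
  have sq: "sq_integrable (\<lambda>w. h v* cadj (?Q w))" for h
    using Q unfolding sq_integrable_kernel_def
    by (intro sq_integrable_bilinear_bounded[OF bounded_bilinear_vector_cadj_mult]) auto
  have "model_channel l P f \<bullet> h = f \<bullet> abs_L2 (\<lambda>w. h v* cadj (?Q w))" for f h
  proof -
    have "model_channel l P f \<bullet> h = (LINT w|lebesgue. (rep_L2 f w v* ?Q w) \<bullet> h)"
      unfolding model_channel_eq
      by (rule integral_inner_left[symmetric])
         (use integrable_vector_kernel_mult[OF sq_integrable_rep_L2 Q] in auto)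
    then show ?thesis
      by (simp only: inner_abs_L2_right[OF sq] inner_vector_matrix_mult)
  qed
  then show ?thesis
    by (intro exI[of _ "\<lambda>h. abs_L2 (\<lambda>w. h v* cadj (?Q w))"] allI)
qed

lemma model_channel_scaleC:
  fixes P :: "real \<Rightarrow> complex^('m::{finite,linorder})^('p::finite)"
  assumes "triangular_model_data l r L S0 P"
  shows "model_channel l P (c *\<^sub>C f) = c *s model_channel l P f"
proof -
  let ?Q = "\<lambda>w. if w \<in> {-l..l} then P w else 0"
  note Q = triangular_model_kernel[OF assms]
  have i: "integrable lebesgue (\<lambda>w. rep_L2 f w v* ?Q w)" for f
    by (intro integrable_vector_kernel_mult Q sq_integrable_rep_L2)
  have "model_channel l P (c *\<^sub>C f) = (LINT w|lebesgue. c *s (rep_L2 f w v* ?Q w))"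
    unfolding model_channel_eq
  proof (rule integral_cong_AE)
    show "AE w in lebesgue. rep_L2 (c *\<^sub>C f) w v* ?Q w = c *s (rep_L2 f w v* ?Q w)"
      using rep_scaleC_L2[of c f] by eventually_elim (simp add: scalar_vector_matrix_assoc)
  qed (use i integrable_bounded_linear[OF bounded_linear_vector_scalar_mult i] in auto)
  also have "\<dots> = c *s model_channel l P f"
    unfolding model_channel_eq
    by (rule integral_bounded_linear[OF bounded_linear_vector_scalar_mult i])
  finally show ?thesis .
qed

section \<open>Compatibility conditions of open systems\<close>

lemma inner_scaleC: "(c *\<^sub>C f) \<bullet> g = f \<bullet> (cnj c *\<^sub>C g)"
  by transfer (simp add: inner_vector_scalar_mult)

lemma scaleC_add_right: "c *\<^sub>C (f + g) = c *\<^sub>C f + c *\<^sub>C g"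
  by transfer (auto simp: L2_rel_def vector_add_ldistrib intro!: sq_integrable_add sq_integrable_scale)

lemma scaleC_diff_right: "c *\<^sub>C (f - g) = c *\<^sub>C f - c *\<^sub>C g"
  by transfer
     (auto simp: L2_rel_def vec.scale_right_diff_distrib intro!: sq_integrable_diff sq_integrable_scale)

lemma scaleC_scaleC: "c *\<^sub>C d *\<^sub>C f = (c * d) *\<^sub>C f"
  by transfer (auto simp: L2_rel_def intro!: sq_integrable_scale)

lemma scaleC_one: "1 *\<^sub>C f = f"
  by transfer (auto simp: L2_rel_def)

lemma scaleC_of_real: "of_real a *\<^sub>C f = a *\<^sub>R f"
  by transfer (auto simp: L2_rel_def scaleR_eq_vector_scalar_mult intro!: sq_integrable_scale)

lemma scaleC_add_left: "(c + d) *\<^sub>C f = c *\<^sub>C f + d *\<^sub>C f"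
  by transfer
     (auto simp: L2_rel_def vector_sadd_rdistrib intro!: sq_integrable_add sq_integrable_scale)

lemma scaleC_uminus_left: "(- c) *\<^sub>C f = - (c *\<^sub>C f)"
  by transfer (auto simp: L2_rel_def intro!: sq_integrable_uminus sq_integrable_scale)

lemma scaleC_Re_Im: "c *\<^sub>C f = Re c *\<^sub>R f + Im c *\<^sub>R \<i> *\<^sub>C f"
  using complex_eq[of c]
  by (metis mult.commute scaleC_add_left scaleC_of_real scaleC_scaleC)

text \<open>Makes exp(-zt) f differentiable in t. Splitting c into real and imaginary parts reduces
  the claim to real scalar multiplication of two fixed vectors.\<close>

lemma bounded_linear_scaleC_left: "bounded_linear (\<lambda>c. c *\<^sub>C f)"
proof -
  have eq: "(\<lambda>c. c *\<^sub>C f) = (\<lambda>c. Re c *\<^sub>R f + Im c *\<^sub>R \<i> *\<^sub>C f)"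
    by (intro ext scaleC_Re_Im)
  show ?thesis
    by (subst eq) (intro bounded_linear_add bounded_linear_compose[OF bounded_linear_scaleR_left]
        bounded_linear_Re bounded_linear_Im)
qed

text \<open>The factor c is conjugated on its way over to T and conjugated back on its return. The
  pairing is only real, so complex homogeneity of T has to be supplied.\<close>

lemma adjoint_scaleC:
  assumes "\<And>f g. T f \<bullet> g = f \<bullet> T' g" and "\<And>c f. T (c *\<^sub>C f) = c *\<^sub>C T f"
  shows "T' (c *\<^sub>C g) = c *\<^sub>C T' g"
proof -
  have "f \<bullet> T' (c *\<^sub>C g) = f \<bullet> c *\<^sub>C T' g" for f
    by (metis assms inner_scaleC complex_cnj_cnj)
  then show ?thesis
    by (rule vector_eq_ldot[THEN iffD1, OF allI])
qed

text \<open>Inner products are linear in each argument and separate vectors. Linearity of A, B and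
  \<open>\<Phi>\<close> is obtained this way, without touching the integrals.\<close>

lemma linear_if_adjoint:
  fixes T :: "'a::real_inner \<Rightarrow> 'b::real_inner"
  assumes "\<And>f g. T f \<bullet> g = f \<bullet> T' g"
  shows "linear T"
proof (rule linearI)
  show "T (f + g) = T f + T g" for f g
    by (rule vector_eq_rdot[THEN iffD1, OF allI]) (simp add: assms inner_add_left)
  show "T (c *\<^sub>R f) = c *\<^sub>R T f" for c f
    by (rule vector_eq_rdot[THEN iffD1, OF allI]) (simp add: assms)
qed

text \<open>Product rule for the evaluation pairing. \<open>Blinfun (T y)\<close> is known to act as
  \<open>T y\<close> only for y in S, hence the transfer within S at the end.\<close>

lemma has_op_derivative_apply:
  assumes T: "has_op_derivative T T' x S" and x: "x \<in> S"
    and g: "(g has_vector_derivative g') (at x within S)"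
  shows "((\<lambda>y. T y (g y)) has_vector_derivative T' (g x) + T x g') (at x within S)"
proof -
  have bl: "\<And>y. y \<in> S \<Longrightarrow> bounded_linear (T y)" and bl': "bounded_linear T'"
    and d: "((\<lambda>y. Blinfun (T y)) has_vector_derivative Blinfun T') (at x within S)"
    using T by (auto simp: has_op_derivative_def)
  have "((\<lambda>y. blinfun_apply (Blinfun (T y)) (g y)) has_vector_derivative
      blinfun_apply (Blinfun (T x)) g' + blinfun_apply (Blinfun T') (g x)) (at x within S)"
    by (rule bounded_bilinear.has_vector_derivative[OF bounded_bilinear_blinfun_apply d g])
  then have "((\<lambda>y. blinfun_apply (Blinfun (T y)) (g y)) has_vector_derivative
      T' (g x) + T x g') (at x within S)"
    by (simp add: bounded_linear_Blinfun_apply bl[OF x] bl' add.commute)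
  then show ?thesis
    by (rule has_vector_derivative_transform[OF x, rotated])
       (simp add: bounded_linear_Blinfun_apply bl)
qed

text \<open>Only t = 0 is needed: there the exponential is 1, and the open system turns into
  equations for the amplitudes u, f and v.\<close>

lemma exp_has_vector_derivative_0:
  "((\<lambda>t. exp (- z * of_real t)) has_vector_derivative - (z :: complex)) (at 0)"
proof -
  have "((\<lambda>w. exp (- z * w)) has_field_derivative - z) (at (of_real 0))"
    by (auto intro!: derivative_eq_intros)
  then show ?thesis
    by (rule has_vector_derivative_real_field)
qed

text \<open>Collects what the compatibility conditions take from the model: existence of adjoints,
  complex homogeneity, Hermitian \<open>\<sigma>A\<close> and \<open>\<sigma>B\<close>. The channel
  space is an arbitrary C^n; the block structure enters later.\<close>

locale open_colligation =
  fixes x0 x1 :: real and D :: "real set" and z :: complex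
    and A B :: "real \<Rightarrow> ('p::finite) L2 \<Rightarrow> 'p L2" and \<Phi> :: "real \<Rightarrow> 'p L2 \<Rightarrow> complex^'n"
    and \<sigma>A \<sigma>B :: "complex^'n^'n" and \<psi> \<psi>' :: "real \<Rightarrow> complex^'n^'n"
    and u v :: "real \<Rightarrow> complex^'n" and f :: "real \<Rightarrow> 'p L2"
  assumes x0_less_x1: "x0 < x1"
    and colligation: "colligation {x0..x1} D A B \<Phi> \<sigma>A \<sigma>B \<psi> \<psi>'"
    and strict: "strict_colligation {x0..x1} D \<Phi>"
    and A_adjoint: "\<And>x g h. x \<in> {x0..x1} \<Longrightarrow> A x g \<bullet> h = g \<bullet> adjoint (A x) h"
    and B_adjoint: "\<And>x g h. x \<in> {x0..x1} \<Longrightarrow> B x g \<bullet> h = g \<bullet> adjoint (B x) h"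
    and \<Phi>_adjoint: "\<And>x g h. x \<in> {x0..x1} \<Longrightarrow> \<Phi> x g \<bullet> h = g \<bullet> adjoint (\<Phi> x) h"
    and A_scaleC: "\<And>x c g. x \<in> {x0..x1} \<Longrightarrow> A x (c *\<^sub>C g) = c *\<^sub>C A x g"
    and B_scaleC: "\<And>x c g. x \<in> {x0..x1} \<Longrightarrow> B x (c *\<^sub>C g) = c *\<^sub>C B x g"
    and \<Phi>_scaleC: "\<And>x c g. x \<in> {x0..x1} \<Longrightarrow> \<Phi> x (c *\<^sub>C g) = c *s \<Phi> x g"
    and hermitian: "cadj \<sigma>A = \<sigma>A" "cadj \<sigma>B = \<sigma>B"
    and differentiable_u: "differentiable_fun {x0..x1} u"
    and f_in: "\<And>x. x \<in> {x0..x1} \<Longrightarrow> f x \<in> L2_on D"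
    and open_system: "open_system {x0..x1} A B \<Phi> \<sigma>A \<sigma>B
           (\<lambda>x t. exp (- z * of_real t) *s u x)
           (\<lambda>x t. exp (- z * of_real t) *\<^sub>C f x)
           (\<lambda>x t. exp (- z * of_real t) *s v x)"
begin

context
  fixes x assumes x: "x \<in> {x0..x1}"
begin

lemma state_equation: "A x (f x) = z *\<^sub>C f x + adjoint (\<Phi> x) (u x v* \<sigma>A)"
proof -
  obtain df where df: "((\<lambda>s. exp (- z * of_real s) *\<^sub>C f x) has_vector_derivative df) (at 0)"
    and eq: "df + A x (f x) = adjoint (\<Phi> x) (u x v* \<sigma>A)"
    using open_system[unfolded open_system_def, rule_format, OF x, of 0]
    by (auto simp: scaleC_one)
  have "((\<lambda>s. exp (- z * of_real s) *\<^sub>C f x) has_vector_derivative (- z) *\<^sub>C f x) (at 0)"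
    by (rule bounded_linear.has_vector_derivative[OF bounded_linear_scaleC_left
          exp_has_vector_derivative_0])
  then have "df = - (z *\<^sub>C f x)"
    using vector_derivative_unique_at[OF df] by (simp add: scaleC_uminus_left)
  then show ?thesis
    using eq by (simp add: algebra_simps)
qed

lemma state_derivative:
  "(f has_vector_derivative (- \<i>) *\<^sub>C (adjoint (\<Phi> x) (u x v* \<sigma>B) - B x (f x))) (at x within {x0..x1})"
proof -
  obtain df where df: "(f has_vector_derivative df) (at x within {x0..x1})"
    and eq: "\<i> *\<^sub>C df + B x (f x) = adjoint (\<Phi> x) (u x v* \<sigma>B)"
    using open_system[unfolded open_system_def, rule_format, OF x, of 0]
    by (auto simp: scaleC_one)
  have "df = (- \<i>) *\<^sub>C \<i> *\<^sub>C df"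
    by (simp add: scaleC_scaleC scaleC_one)
  also have "\<i> *\<^sub>C df = adjoint (\<Phi> x) (u x v* \<sigma>B) - B x (f x)"
    using eq by (simp add: algebra_simps)
  finally show ?thesis using df by simp
qed

lemma output_equation: "v x = u x - \<i> *s \<Phi> x (f x)"
  using open_system[unfolded open_system_def, rule_format, OF x, of 0, THEN conjunct2, THEN conjunct2]
  by (simp add: scaleC_one)

lemma linear_A: "linear (A x)" and linear_B: "linear (B x)" and linear_\<Phi>: "linear (\<Phi> x)"
  by (rule linear_if_adjoint, rule A_adjoint[OF x] B_adjoint[OF x] \<Phi>_adjoint[OF x])+

text \<open>One derivative \<open>d\<Phi>\<close> serves both channel equations. Each is solved for
  the product with \<open>\<sigma>A\<close>, the only form in which the derivative occurs.\<close>

lemma \<Phi>_derivative: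
  obtains d\<Phi> where "has_op_derivative \<Phi> d\<Phi> x {x0..x1}"
    and "\<And>g. g \<in> L2_on D \<Longrightarrow> d\<Phi> g v* \<sigma>A
      = \<i> *s (\<Phi> x g v* \<psi> x - \<Phi> x (adjoint (B x) g) v* \<sigma>A + \<Phi> x (adjoint (A x) g) v* \<sigma>B)"
    and "\<And>g. g \<in> L2_on D \<Longrightarrow> d\<Phi> g v* \<sigma>A
      = \<i> *s (\<Phi> x g v* \<psi>' x - \<Phi> x (B x g) v* \<sigma>A + \<Phi> x (A x g) v* \<sigma>B)"
proof -
  have rot: "d = \<i> *s (c - a + b)" if "(1 / \<i>) *s d + a - b = c" for a b c d :: "complex^'n"
    unfolding that[symmetric] by (simp add: vec_eq_iff)
  obtain d\<Phi> where d: "has_op_derivative \<Phi> d\<Phi> x {x0..x1}"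
    and eqs: "\<forall>f\<in>L2_on D. (1 / \<i>) *s (d\<Phi> f v* \<sigma>A) + \<Phi> x (adjoint (B x) f) v* \<sigma>A
             - \<Phi> x (adjoint (A x) f) v* \<sigma>B = \<Phi> x f v* \<psi> x"
      "\<forall>f\<in>L2_on D. (1 / \<i>) *s (d\<Phi> f v* \<sigma>A) + \<Phi> x (B x f) v* \<sigma>A
             - \<Phi> x (A x f) v* \<sigma>B = \<Phi> x f v* \<psi>' x"
    using colligation x unfolding colligation_def by meson
  show thesis
    by (rule that[OF d]; rule rot, erule eqs[THEN bspec])
qed

lemma input_compatibility:
  assumes du: "(u has_vector_derivative du) (at x within {x0..x1})"
  shows "du v* \<sigma>A = \<i> *s (u x v* (z *\<^sub>M \<sigma>B + \<psi> x))"
proof -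
  obtain d\<Phi> where d\<Phi>: "has_op_derivative \<Phi> d\<Phi> x {x0..x1}"
    and d\<Phi>_eq: "\<And>g. g \<in> L2_on D \<Longrightarrow> d\<Phi> g v* \<sigma>A
      = \<i> *s (\<Phi> x g v* \<psi> x - \<Phi> x (adjoint (B x) g) v* \<sigma>A + \<Phi> x (adjoint (A x) g) v* \<sigma>B)"
    using \<Phi>_derivative by metis
  obtain dA where dA: "has_op_derivative A dA x {x0..x1}"
    and dA_eq: "\<i> *\<^sub>C dA (f x) = A x (B x (f x)) - B x (A x (f x))"
    using colligation x f_in[OF x] unfolding colligation_def by meson
  define N where "N = adjoint (\<Phi> x) (u x v* \<sigma>B)"
  define M where "M = adjoint (\<Phi> x) (u x v* \<sigma>A)"
  define df where "df = (- \<i>) *\<^sub>C (N - B x (f x))"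
  have df: "(f has_vector_derivative df) (at x within {x0..x1})"
    using state_derivative by (simp add: df_def N_def)
  have dAf: "dA (f x) = (- \<i>) *\<^sub>C (A x (B x (f x)) - B x (A x (f x)))"
    unfolding dA_eq[symmetric] by (simp add: scaleC_scaleC scaleC_one)
  have Adf: "A x df = (- \<i>) *\<^sub>C (A x N - A x (B x (f x)))"
    by (simp only: df_def A_scaleC[OF x] linear_diff[OF linear_A])
  have BAf: "B x (A x (f x)) = z *\<^sub>C B x (f x) + B x M"
    by (simp only: state_equation M_def B_scaleC[OF x] linear_add[OF linear_B])
  have zdf: "z *\<^sub>C df = (- \<i>) *\<^sub>C (z *\<^sub>C N - z *\<^sub>C B x (f x))"
    by (simp only: df_def scaleC_scaleC scaleC_diff_right mult.commute)
  \<comment> \<open>The terms A B f from the Lax equation and from f' cancel. The state equation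
    turns B A f into z B f + B M, and z B f cancels against z f'. Only the input terms N and M
    survive.\<close>
  have total: "dA (f x) + A x df - z *\<^sub>C df = (- \<i>) *\<^sub>C (A x N - B x M - z *\<^sub>C N)"
    by (simp add: dAf Adf zdf BAf scaleC_add_right scaleC_diff_right)
  have "(du v* \<sigma>A) \<bullet> \<Phi> x g = (\<i> *s (u x v* (z *\<^sub>M \<sigma>B + \<psi> x))) \<bullet> \<Phi> x g"
    if g: "g \<in> L2_on D" for g
  proof -
    \<comment> \<open>The factor z is moved onto g beforehand, so that f is paired with a vector
      independent of y.\<close>
    have "((\<lambda>y. A y (f y) \<bullet> g - f y \<bullet> (cnj z *\<^sub>C g)) has_vector_derivative
        (dA (f x) + A x df) \<bullet> g - df \<bullet> (cnj z *\<^sub>C g)) (at x within {x0..x1})"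
      by (intro has_vector_derivative_diff
          bounded_linear.has_vector_derivative[OF bounded_linear_inner_left]
          has_op_derivative_apply[OF dA x df] df)
    \<comment> \<open>By the state equation at every y of the interval this is the same function as
      in \<open>r\<close>; its derivative is thus computed in two ways.\<close>
    then have l: "((\<lambda>y. (u y v* \<sigma>A) \<bullet> \<Phi> y g) has_vector_derivative
        (dA (f x) + A x df) \<bullet> g - df \<bullet> (cnj z *\<^sub>C g)) (at x within {x0..x1})"
    proof (rule has_vector_derivative_transform[OF x, rotated])
      show "(u y v* \<sigma>A) \<bullet> \<Phi> y g = A y (f y) \<bullet> g - f y \<bullet> (cnj z *\<^sub>C g)" if "y \<in> {x0..x1}" for y
        using \<Phi>_adjoint[OF that, of g "u y v* \<sigma>A"]
        by (simp add: open_colligation.state_equation[OF open_colligation_axioms that]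
            inner_add_left inner_scaleC inner_commute[of "\<Phi> y g"] inner_commute[of g])
    qed
    have r: "((\<lambda>y. (u y v* \<sigma>A) \<bullet> \<Phi> y g) has_vector_derivative
        (u x v* \<sigma>A) \<bullet> d\<Phi> g + (du v* \<sigma>A) \<bullet> \<Phi> x g) (at x within {x0..x1})"
      using bounded_bilinear.has_vector_derivative[OF bounded_bilinear_inner
          bounded_linear.has_vector_derivative[OF bounded_linear_vector_matrix_mult du]
          has_op_derivative_apply[OF d\<Phi> x has_vector_derivative_const]]
        linear_0[OF linear_\<Phi>] by simp
    \<comment> \<open>Derivatives within the interval are unique, also at its endpoints, because x0
      < x1.\<close>
    have "(dA (f x) + A x df) \<bullet> g - df \<bullet> (cnj z *\<^sub>C g)
        = (u x v* \<sigma>A) \<bullet> d\<Phi> g + (du v* \<sigma>A) \<bullet> \<Phi> x g"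
      using vector_derivative_unique_within_closed_interval[unfolded box_real, OF x0_less_x1 x l r] .
    moreover have "(dA (f x) + A x df) \<bullet> g - df \<bullet> (cnj z *\<^sub>C g)
        = (A x N - B x M - z *\<^sub>C N) \<bullet> (\<i> *\<^sub>C g)"
      using arg_cong[OF total, of "\<lambda>h. h \<bullet> g"] by (simp add: inner_diff_left inner_scaleC)
    moreover have "(A x N - B x M - z *\<^sub>C N) \<bullet> (\<i> *\<^sub>C g)
        = (u x v* \<sigma>B) \<bullet> (\<i> *s \<Phi> x (adjoint (A x) g)) - (u x v* \<sigma>A) \<bullet> (\<i> *s \<Phi> x (adjoint (B x) g))
          - (z *s (u x v* \<sigma>B)) \<bullet> (\<i> *s \<Phi> x g)"
    proof -
      have t: "adjoint (\<Phi> x) h \<bullet> k = h \<bullet> \<Phi> x k" for h k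
        using \<Phi>_adjoint[OF x, of k h] by (simp add: inner_commute)
      have "adjoint (A x) (\<i> *\<^sub>C g) = \<i> *\<^sub>C adjoint (A x) g"
        "adjoint (B x) (\<i> *\<^sub>C g) = \<i> *\<^sub>C adjoint (B x) g"
        by (rule adjoint_scaleC[OF A_adjoint[OF x] A_scaleC[OF x]])
          (rule adjoint_scaleC[OF B_adjoint[OF x] B_scaleC[OF x]])
      then show ?thesis
        by (simp add: inner_diff_left A_adjoint[OF x] B_adjoint[OF x] inner_scaleC
            inner_vector_scalar_mult N_def M_def t \<Phi>_scaleC[OF x])
    qed
    moreover have "(u x v* \<sigma>A) \<bullet> d\<Phi> g
        = (u x v* \<psi> x) \<bullet> (\<i> *s \<Phi> x g) - (u x v* \<sigma>A) \<bullet> (\<i> *s \<Phi> x (adjoint (B x) g))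
          + (u x v* \<sigma>B) \<bullet> (\<i> *s \<Phi> x (adjoint (A x) g))"
    proof -
      have "cadj (\<psi> x) = \<psi> x"
        using colligation x by (auto simp: colligation_def)
      then show ?thesis
        by (simp add: inner_vector_matrix_mult hermitian d\<Phi>_eq[OF g] vector_add_ldistrib
            vec.scale_right_diff_distrib inner_add_right inner_diff_right scalar_vector_matrix_assoc)
    qed
    \<comment> \<open>The terms with \<open>adjoint (A x) g\<close> and
      \<open>adjoint (B x) g\<close> occur identically in both computations and drop out.\<close>
    ultimately have "(du v* \<sigma>A) \<bullet> \<Phi> x g
        = - ((u x v* \<psi> x) \<bullet> (\<i> *s \<Phi> x g) + (z *s (u x v* \<sigma>B)) \<bullet> (\<i> *s \<Phi> x g))"
      by linarith
    also have "\<dots> = (\<i> *s (u x v* (z *\<^sub>M \<sigma>B + \<psi> x))) \<bullet> \<Phi> x g"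
      unfolding vector_matrix_mult_add_rdistrib vector_matrix_mult_mscale inner_vector_scalar_mult[of \<i>]
      by (simp add: inner_add_left)
    finally show ?thesis .
  qed
  \<comment> \<open>Strictness: the vectors \<open>\<Phi> x g\<close> exhaust the channel space, so
    the tested identity holds for all h.\<close>
  moreover have "\<Phi> x ` L2_on D = UNIV"
    using strict x by (simp add: strict_colligation_def)
  ultimately have "(du v* \<sigma>A) \<bullet> h = (\<i> *s (u x v* (z *\<^sub>M \<sigma>B + \<psi> x))) \<bullet> h" for h
    by (metis (no_types, lifting) UNIV_I imageE)
  then show ?thesis
    by (rule vector_eq_rdot[THEN iffD1, OF allI])
qed

text \<open>The channel equation in B and A, rather than in their adjoints, is the one evaluated at
  f x: there the B terms cancel against those from f', and A f is replaced by z f + M.\<close>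

lemma output_compatibility:
  assumes dv: "(v has_vector_derivative dv) (at x within {x0..x1})"
  shows "dv v* \<sigma>A = \<i> *s (v x v* (z *\<^sub>M \<sigma>B + \<psi>' x))"
proof -
  obtain du where du: "(u has_vector_derivative du) (at x within {x0..x1})"
    using differentiable_u x vector_derivative_works by blast
  obtain d\<Phi> where d\<Phi>: "has_op_derivative \<Phi> d\<Phi> x {x0..x1}"
    and d\<Phi>_eq: "\<And>g. g \<in> L2_on D \<Longrightarrow> d\<Phi> g v* \<sigma>A
      = \<i> *s (\<Phi> x g v* \<psi>' x - \<Phi> x (B x g) v* \<sigma>A + \<Phi> x (A x g) v* \<sigma>B)"
    using \<Phi>_derivative by metis
  define N where "N = adjoint (\<Phi> x) (u x v* \<sigma>B)"
  define M where "M = adjoint (\<Phi> x) (u x v* \<sigma>A)"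
  have "((\<lambda>y. u y - \<i> *s \<Phi> y (f y)) has_vector_derivative
      du - \<i> *s (d\<Phi> (f x) + \<Phi> x ((- \<i>) *\<^sub>C (N - B x (f x))))) (at x within {x0..x1})"
    unfolding N_def
    by (intro has_vector_derivative_diff du has_op_derivative_apply[OF d\<Phi> x state_derivative]
        bounded_linear.has_vector_derivative[OF bounded_linear_vector_scalar_mult])
  then have "(v has_vector_derivative
      du - \<i> *s (d\<Phi> (f x) + \<Phi> x ((- \<i>) *\<^sub>C (N - B x (f x))))) (at x within {x0..x1})"
    by (rule has_vector_derivative_transform[OF x, rotated])
       (rule open_colligation.output_equation[OF open_colligation_axioms])
  then have "dv = du - \<i> *s (d\<Phi> (f x) + \<Phi> x ((- \<i>) *\<^sub>C (N - B x (f x))))"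
    using vector_derivative_unique_within_closed_interval[unfolded box_real, OF x0_less_x1 x dv] by simp
  also have "\<dots> = du - \<i> *s d\<Phi> (f x) - \<Phi> x N + \<Phi> x (B x (f x))"
    by (simp add: \<Phi>_scaleC[OF x] linear_diff[OF linear_\<Phi>] vec_eq_iff algebra_simps)
  finally have "dv v* \<sigma>A = du v* \<sigma>A - \<i> *s (d\<Phi> (f x) v* \<sigma>A) - \<Phi> x N v* \<sigma>A
      + \<Phi> x (B x (f x)) v* \<sigma>A"
    by (simp add: vector_matrix_left_distrib scalar_vector_matrix_assoc
        vector_matrix_mult_diff_distrib)
  also have "\<dots> = \<i> *s (u x v* (z *\<^sub>M \<sigma>B + \<psi> x)) + \<Phi> x (f x) v* \<psi>' x
      + z *s (\<Phi> x (f x) v* \<sigma>B) - (\<Phi> x N v* \<sigma>A - \<Phi> x M v* \<sigma>B)"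
    unfolding input_compatibility[OF du] d\<Phi>_eq[OF f_in[OF x]] state_equation M_def[symmetric]
      linear_add[OF linear_\<Phi>] \<Phi>_scaleC[OF x] vector_matrix_left_distrib scalar_vector_matrix_assoc
    by (simp add: vec_eq_iff algebra_simps)
  \<comment> \<open>This is the linkage condition between \<open>\<psi>\<close> and
    \<open>\<psi>'\<close> tested on the input u x.\<close>
  also have "\<Phi> x N v* \<sigma>A - \<Phi> x M v* \<sigma>B = (- \<i>) *s (u x v* \<psi>' x - u x v* \<psi> x)"
  proof -
    have eq: "u x v* \<psi>' x = u x v* \<psi> x + \<i> *s (\<Phi> x N v* \<sigma>A - \<Phi> x M v* \<sigma>B)"
      using colligation x by (auto simp: colligation_def N_def M_def)
    show ?thesis
      unfolding eq by (simp add: vec_eq_iff)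
  qed
  also have "\<i> *s (u x v* (z *\<^sub>M \<sigma>B + \<psi> x)) + \<Phi> x (f x) v* \<psi>' x + z *s (\<Phi> x (f x) v* \<sigma>B)
      - (- \<i>) *s (u x v* \<psi>' x - u x v* \<psi> x) = \<i> *s (v x v* (z *\<^sub>M \<sigma>B + \<psi>' x))"
    by (simp add: output_equation vector_matrix_mult_add_rdistrib vector_matrix_mult_mscale
        scalar_vector_matrix_assoc vector_matrix_mult_diff_distrib
        vec_eq_iff algebra_simps)
  finally show ?thesis .
qed

text \<open>The resolvent in \<open>characteristic_op\<close> is an \<open>inv_into\<close>. Outside
  the spectrum A - z has a left inverse on \<open>L2_on D\<close>, hence is injective there, and f x
  is the unique preimage named by the state equation.\<close>

lemma output_eq_characteristic_op:
  assumes "z \<notin> spectrum_on D (A x)"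
  shows "v x = characteristic_op D (A x) (\<Phi> x) \<sigma>A z (u x)"
proof -
  obtain R where R: "\<And>g. g \<in> L2_on D \<Longrightarrow> R (A x g - z *\<^sub>C g) = g"
    using assms by (auto simp: spectrum_on_def)
  have "inj_on (\<lambda>g. A x g - z *\<^sub>C g) (L2_on D)"
    by (rule inj_on_inverseI[of _ R]) (rule R)
  then have "inv_into (L2_on D) (\<lambda>g. A x g - z *\<^sub>C g) (A x (f x) - z *\<^sub>C f x) = f x"
    using f_in[OF x] by (rule inv_into_f_f)
  moreover have "A x (f x) - z *\<^sub>C f x = adjoint (\<Phi> x) (u x v* \<sigma>A)"
    by (simp add: state_equation)
  ultimately show ?thesis
    by (simp add: characteristic_op_def output_equation)
qed

end

end

section \<open>Sturm-Liouville equations\<close>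

lemma sum_UNIV_sum:
  "(\<Sum>i\<in>UNIV. g i) = (\<Sum>i\<in>UNIV. g (Inl i)) + (\<Sum>i\<in>UNIV. g (Inr (i :: 'b::finite) :: 'a::finite + 'b))"
  unfolding UNIV_Plus_UNIV[symmetric] by (subst sum.Plus) auto

lemma vpair_inner: "vpair a b \<bullet> vpair c d = a \<bullet> c + b \<bullet> d"
  by (simp add: vpair_def inner_vec_def sum_UNIV_sum)

lemma vpair_eq_iff: "vpair a b = vpair c d \<longleftrightarrow> a = c \<and> b = d"
  by (auto simp: vpair_def vec_eq_iff split: sum.split)

lemma vpair_cases: obtains a b where "h = vpair a (b :: complex^'m)"
proof
  show "h = vpair (\<chi> i. h $ Inl i) (\<chi> i. h $ Inr i)"
    by (simp add: vpair_def vec_eq_iff split: sum.split)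
qed

lemma vpair_scale: "c *s vpair a b = vpair (c *s a) (c *s b)"
  by (simp add: vpair_def vec_eq_iff split: sum.split)

lemma vpair_add: "vpair a b + vpair c d = vpair (a + c) (b + d)"
  by (simp add: vpair_def vec_eq_iff split: sum.split)

lemma vpair_block_mult:
  "vpair a b v* block M11 M12 M21 M22 = vpair (a v* M11 + b v* M21) (a v* M12 + b v* M22)"
  by (simp add: vpair_def block_def vec_eq_iff vector_matrix_mult_def sum_UNIV_sum split: sum.split)

lemma block_mult:
  "block A B C D ** block E F G H
    = block (A ** E + B ** G) (A ** F + B ** H) (C ** E + D ** G) (C ** F + D ** H)"
  by (simp add: block_def vec_eq_iff matrix_matrix_mult_def sum_UNIV_sum split: sum.split)

lemma block_one: "block (mat 1) 0 0 (mat 1) = mat 1"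
  by (auto simp: block_def vec_eq_iff mat_def split: sum.split)

lemma mscale_mult_left: "(c *\<^sub>M M) ** N = c *\<^sub>M (M ** N)"
  by (simp add: mscale_def vec_eq_iff matrix_matrix_mult_def sum_distrib_left mult_ac)

lemma mscale_mult_right: "M ** (c *\<^sub>M N) = c *\<^sub>M (M ** N)"
  by (simp add: mscale_def vec_eq_iff matrix_matrix_mult_def sum_distrib_left mult_ac)

lemma mscale_mscale: "c *\<^sub>M d *\<^sub>M M = (c * d) *\<^sub>M M"
  by (simp add: mscale_def vec_eq_iff)

lemma mscale_one: "1 *\<^sub>M M = M"
  by (simp add: mscale_def vec_eq_iff)

lemma mscale_zero: "c *\<^sub>M 0 = 0"
  by (simp add: mscale_def vec_eq_iff)

lemma invertible_sigma_A:
  assumes "invertible L" "b \<noteq> 0"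
  shows "invertible (sigma_A b L)"
proof -
  obtain L' where L': "L ** L' = mat 1" "L' ** L = mat 1"
    using assms(1) by (auto simp: invertible_def)
  \<comment> \<open>An off-diagonal block matrix is inverted by exchanging the two blocks and
    inverting them; here both are b L.\<close>
  let ?X = "block 0 (of_real (1 / b) *\<^sub>M L') (of_real (1 / b) *\<^sub>M L') 0"
  have "sigma_A b L ** ?X = mat 1" "?X ** sigma_A b L = mat 1"
    using assms(2)
    by (simp_all add: sigma_A_def block_mult mscale_mult_left mscale_mult_right mscale_mscale L'
        mscale_one mscale_zero block_one)
  then show ?thesis
    by (auto simp: invertible_def)
qed

lemma cadj_sigma_A: "cadj L = L \<Longrightarrow> cadj (sigma_A b L) = sigma_A b L"
  by (simp add: sigma_A_def block_def cadj_def mscale_def vec_eq_iff split: sum.split)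

lemma cadj_sigma_B: "cadj L = L \<Longrightarrow> cadj (sigma_B L) = sigma_B L"
  by (simp add: sigma_B_def block_def cadj_def vec_eq_iff split: sum.split)

section \<open>From the compatibility condition to equations of second order\<close>

lemma compatibility_components:
  assumes "invertible L" "b \<noteq> 0"
    and "vpair d1 d2 v* sigma_A b L
      = \<i> *s (vpair u1 u2 v* (z *\<^sub>M sigma_B L + psi_form b L N11 N12))"
  shows "d1 = - (u1 v* L v* N12) + \<i> *s u2"
    and "d2 = (\<i> * (z / of_real b)) *s u1 + \<i> *s (u1 v* L v* N11) + u2 v* L v* cadj N12"
proof -
  let ?e1 = "- (u1 v* L v* N12) + \<i> *s u2"
  let ?e2 = "(\<i> * (z / of_real b)) *s u1 + \<i> *s (u1 v* L v* N11) + u2 v* L v* cadj N12"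
  have b: "x = y" if "of_real b *s x = of_real b *s y" for x y :: "complex^'a"
    using that assms(2) by (simp add: vec_eq_iff)
  note expand = vector_matrix_mult_add_rdistrib vector_matrix_mult_mscale vector_matrix_mult_uminus
    vector_matrix_left_distrib uminus_vector_matrix_mult
    scalar_vector_matrix_assoc vector_matrix_mul_assoc[symmetric]
  \<comment> \<open>\<open>sigma_A\<close> exchanges the components, so the first component of the
    equation determines d2 and the second d1. The parameter z reaches d2 only, because
    \<open>sigma_B\<close> has a single nonzero block.\<close>
  have scaled: "of_real b *s (d2 v* L) = \<i> *s (z *s (u1 v* L) + of_real b *s (u1 v* L v* N11 v* L)
        - (\<i> * of_real b) *s (u2 v* L v* cadj N12 v* L))"
    "of_real b *s (d1 v* L) = \<i> *s ((\<i> * of_real b) *s (u1 v* L v* N12 v* L)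
        + of_real b *s (u2 v* L))"
    using assms(3)
    by (simp_all add: sigma_A_def sigma_B_def psi_form_def expand
        vpair_block_mult vpair_scale vpair_add vpair_eq_iff)
  have eqs: "of_real b *s (d2 v* L) = of_real b *s (?e2 v* L)"
    "of_real b *s (d1 v* L) = of_real b *s (?e1 v* L)"
    unfolding scaled expand using assms(2) by (simp_all add: vec_eq_iff algebra_simps)
  show "d1 = ?e1" "d2 = ?e2"
    using invertible_vector_matrix_mult_cancel[OF assms(1) b[OF eqs(2)]]
      invertible_vector_matrix_mult_cancel[OF assms(1) b[OF eqs(1)]]
    by auto
qed

lemma bounded_linear_component_vectors:
  "bounded_linear (\<lambda>h :: complex^('a::finite + 'b::finite). \<chi> i. h $ Inl i)"
  "bounded_linear (\<lambda>h :: complex^('a::finite + 'b::finite). \<chi> i. h $ Inr i)"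
  by (auto intro!: linear_conv_bounded_linear[THEN iffD1] linearI simp: vec_eq_iff)

text \<open>Stated for a generic pair N11, N12 because input and output obey the same kind of
  system, with different matrix functions.\<close>

lemma sturm_liouville_of_compatibility:
  fixes u1 u2 :: "real \<Rightarrow> complex^'m"
  assumes S: "S = {x0..x1}" and "x0 < x1" and L: "invertible L" and b: "b \<noteq> 0"
    and u: "\<And>x. x \<in> S \<Longrightarrow> u x = vpair (u1 x) (u2 x)"
    and diff: "differentiable_fun S u" "differentiable_fun S N11" "differentiable_fun S N12"
    and compat: "\<And>x du. x \<in> S \<Longrightarrow> (u has_vector_derivative du) (at x within S) \<Longrightarrow>
       du v* sigma_A b L = \<i> *s (u x v* (z *\<^sub>M sigma_B L + psi_form b L (N11 x) (N12 x)))"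
    and N: "\<And>x. x \<in> S \<Longrightarrow> N12 x = cadj (N12 x)"
      "\<And>x. x \<in> S \<Longrightarrow> - (N12 x ** L ** N11 x) + N11 x ** L ** cadj (N12 x) + ddx S N11 x = 0"
  shows "sturm_liouville S (\<lambda>x. (L ** N12 x) ** (L ** N12 x) - L ** N11 x - L ** ddx S N12 x)
      (z / of_real b) u1" (is ?goal1)
    and "sturm_liouville S (\<lambda>x. (L ** N12 x) ** (L ** N12 x) - L ** N11 x + L ** ddx S N12 x)
      (z / of_real b) u2" (is ?goal2)
proof -
  let ?\<mu> = "z / of_real b"
  \<comment> \<open>The right-hand sides of the first order system, with \<open>cadj (N12 x)\<close>
    replaced by \<open>N12 x\<close>. As products of differentiable functions they yield the second
    derivatives.\<close>
  define d1 where "d1 x = - (u1 x v* L v* N12 x) + \<i> *s u2 x" for x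
  define d2 where "d2 x = (\<i> * ?\<mu>) *s u1 x + \<i> *s (u1 x v* L v* N11 x) + u2 x v* L v* N12 x" for x
  have first: "(u1 has_vector_derivative d1 x) (at x within S)"
    "(u2 has_vector_derivative d2 x) (at x within S)" if x: "x \<in> S" for x
  proof -
    obtain du where du: "(u has_vector_derivative du) (at x within S)"
      using diff(1) x vector_derivative_works by blast
    obtain e1 e2 where e: "du = vpair e1 e2"
      by (rule vpair_cases)
    have "e1 = d1 x" "e2 = d2 x"
      using compatibility_components[OF L b compat[OF x du, unfolded e u[OF x]]] N(1)[OF x]
      by (simp_all add: d1_def d2_def)
    moreover have "(u1 has_vector_derivative (\<chi> i. du $ Inl i)) (at x within S)"
      by (rule has_vector_derivative_transform[OF x _
            bounded_linear.has_vector_derivative[OF bounded_linear_component_vectors(1) du]])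
         (simp add: u vpair_def vec_eq_iff)
    moreover have "(u2 has_vector_derivative (\<chi> i. du $ Inr i)) (at x within S)"
      by (rule has_vector_derivative_transform[OF x _
            bounded_linear.has_vector_derivative[OF bounded_linear_component_vectors(2) du]])
         (simp add: u vpair_def vec_eq_iff)
    moreover have "(\<chi> i. du $ Inl i) = e1" "(\<chi> i. du $ Inr i) = e2"
      by (simp_all add: e vpair_def vec_eq_iff)
    ultimately show "(u1 has_vector_derivative d1 x) (at x within S)"
      "(u2 has_vector_derivative d2 x) (at x within S)"
      by simp_all
  qed
  have dN: "(N11 has_vector_derivative ddx S N11 x) (at x within S)"
    "(N12 has_vector_derivative ddx S N12 x) (at x within S)" if "x \<in> S" for x
    using diff that vector_derivative_works by blast+
  have prod: "((\<lambda>y. g y v* L v* M y) has_vector_derivative g x v* L v* M' + g' v* L v* M x)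
      (at x within S)"
    if "(g has_vector_derivative g') (at x within S)" "(M has_vector_derivative M') (at x within S)"
    for g g' x and M :: "real \<Rightarrow> complex^'m^'m" and M'
    by (rule bounded_bilinear.has_vector_derivative[OF bounded_bilinear_vector_matrix_mult
          bounded_linear.has_vector_derivative[OF bounded_linear_vector_matrix_mult that(1)] that(2)])
  note scale = bounded_linear.has_vector_derivative[OF bounded_linear_vector_scalar_mult]
  note expand = vector_matrix_left_distrib uminus_vector_matrix_mult scalar_vector_matrix_assoc
    vector_matrix_mult_diff_rdistrib vector_matrix_mult_add_rdistrib
    vector_matrix_mul_assoc[symmetric]
  show ?goal1
    unfolding sturm_liouville_def
  proof (intro exI ballI conjI)
    fix x assume x: "x \<in> S"
    show "(u1 has_vector_derivative d1 x) (at x within S)"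
      by (rule first[OF x])
    show "(d1 has_vector_derivative
        - (u1 x v* L v* ddx S N12 x + d1 x v* L v* N12 x) + \<i> *s d2 x) (at x within S)"
      unfolding d1_def[abs_def]
      by (intro has_vector_derivative_add has_vector_derivative_minus prod scale dN
          first[OF x, unfolded d1_def] x)
    \<comment> \<open>The terms in u2 cancel because N12 is Hermitian: one comes from d1 v* L v*
      N12, the other from d2.\<close>
    show "- (- (u1 x v* L v* ddx S N12 x + d1 x v* L v* N12 x) + \<i> *s d2 x)
        + u1 x v* ((L ** N12 x) ** (L ** N12 x) - L ** N11 x - L ** ddx S N12 x) = ?\<mu> *s u1 x"
      unfolding d1_def d2_def expand
      by (simp add: vec_eq_iff algebra_simps)
  qed
  show ?goal2
    unfolding sturm_liouville_def
  proof (intro exI ballI conjI)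
    fix x assume x: "x \<in> S"
    show "(u2 has_vector_derivative d2 x) (at x within S)"
      by (rule first[OF x])
    show "(d2 has_vector_derivative
        (\<i> * ?\<mu>) *s d1 x + \<i> *s (u1 x v* L v* ddx S N11 x + d1 x v* L v* N11 x)
          + (u2 x v* L v* ddx S N12 x + d2 x v* L v* N12 x)) (at x within S)"
      unfolding d2_def[abs_def]
      by (intro has_vector_derivative_add prod scale dN first[OF x, unfolded d2_def] x)
    \<comment> \<open>Solved for the derivative of N11, the commutator condition removes the
      remaining terms in u1; those carrying z cancel by themselves.\<close>
    have dN11: "ddx S N11 x = N12 x ** L ** N11 x - N11 x ** L ** N12 x"
      using N[OF x] by (simp add: algebra_simps)
    show "- ((\<i> * ?\<mu>) *s d1 x + \<i> *s (u1 x v* L v* ddx S N11 x + d1 x v* L v* N11 x)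
          + (u2 x v* L v* ddx S N12 x + d2 x v* L v* N12 x))
        + u2 x v* ((L ** N12 x) ** (L ** N12 x) - L ** N11 x + L ** ddx S N12 x) = ?\<mu> *s u2 x"
      unfolding d1_def d2_def dN11 expand
      by (simp add: vec_eq_iff algebra_simps)
  qed
qed

section \<open>The triangular model as an open colligation\<close>

lemma double_channel_adjoint:
  fixes \<Phi> :: "('p::finite) L2 \<Rightarrow> complex^'m"
  assumes T: "\<And>f h. \<Phi> f \<bullet> h = f \<bullet> T h" and B: "\<And>f g. B f \<bullet> g = f \<bullet> adjoint B g"
  shows "double_channel \<Phi> B f \<bullet> h = f \<bullet> adjoint (double_channel \<Phi> B) h"
proof -
  \<comment> \<open>The second channel component is the model channel after the adjoint of B, so its
    own adjoint is B after T.\<close>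
  let ?T = "\<lambda>h. T (\<chi> i. h $ Inl i) + B (T (\<chi> i. h $ Inr i))"
  have "double_channel \<Phi> B f \<bullet> h = f \<bullet> ?T h" for f h
  proof -
    obtain h1 h2 where h: "h = vpair h1 h2"
      by (rule vpair_cases)
    have "(\<chi> i. h $ Inl i) = h1" "(\<chi> i. h $ Inr i) = h2"
      by (simp_all add: h vpair_def vec_eq_iff)
    then show ?thesis
      using B[of "T h2" f]
      by (simp add: double_channel_def h vpair_inner T inner_add_right
          inner_commute[of "adjoint B f"] inner_commute[of f "B _"])
  qed
  then have "adjoint (double_channel \<Phi> B) = ?T"
    by (intro adjoint_unique) blast
  then show ?thesis
    using \<open>\<And>f h. double_channel \<Phi> B f \<bullet> h = f \<bullet> ?T h\<close> by simp
qed

theorem theorem7p2: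
  fixes l b x0 x1 :: real and r :: nat and z :: complex
    and L S0 :: "complex^('m::{finite,linorder})^('m::{finite,linorder})"
    and P :: "real \<Rightarrow> real \<Rightarrow> complex^('m::{finite,linorder})^('p::finite)"
    and A B U :: "real \<Rightarrow> 'p L2 \<Rightarrow> 'p L2"
    and \<Phi> :: "real \<Rightarrow> 'p L2 \<Rightarrow> complex^(('m::{finite,linorder}) + ('m::{finite,linorder}))"
    and \<psi> \<psi>' :: "real \<Rightarrow> complex^(('m::{finite,linorder}) + ('m::{finite,linorder}))^(('m::{finite,linorder}) + ('m::{finite,linorder}))"
    and \<psi>11 \<psi>12 \<psi>'11 \<psi>'12 :: "real \<Rightarrow> complex^('m::{finite,linorder})^('m::{finite,linorder})"
    and u v :: "real \<Rightarrow> complex^(('m::{finite,linorder}) + ('m::{finite,linorder}))"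
    and u1 u2 v1 v2 :: "real \<Rightarrow> complex^('m::{finite,linorder})"
    and f :: "real \<Rightarrow> 'p L2"
    and D S :: "real set"
  assumes D: "D = {-l..l}" and S: "S = {x0..x1}" and "x0 < x1" and "b \<noteq> 0"
    and "\<And>x. x \<in> S \<Longrightarrow> triangular_model_data l r L S0 (\<lambda>w. P w x)"
    and "\<And>x. x \<in> S \<Longrightarrow> B x = triangular_op l L S0 (\<lambda>w. P w x)"
    and "\<And>x. x \<in> S \<Longrightarrow> unitary_on D (U x)"
    and "\<And>x g. x \<in> S \<Longrightarrow> g \<in> L2_on D \<Longrightarrow> adjoint (B x) g = - U x (B x (adjoint (U x) g))"
    and "\<And>x g. x \<in> S \<Longrightarrow> A x g = b *\<^sub>R B x (B x g)"
    and "\<And>x. x \<in> S \<Longrightarrow> \<Phi> x = double_channel (model_channel l (\<lambda>w. P w x)) (B x)"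
    and "colligation S D A B \<Phi> (sigma_A b L) (sigma_B L) \<psi> \<psi>'"
    and "strict_colligation S D \<Phi>"
    and "\<And>x. x \<in> S \<Longrightarrow> \<psi> x = psi_form b L (\<psi>11 x) (\<psi>12 x)"
    and "\<And>x. x \<in> S \<Longrightarrow> \<psi>' x = psi_form b L (\<psi>'11 x) (\<psi>'12 x)"
    and "\<And>x. x \<in> S \<Longrightarrow> cadj (\<psi>11 x) = \<psi>11 x"
    and "\<And>x. x \<in> S \<Longrightarrow> cadj (\<psi>'11 x) = \<psi>'11 x"
    and "differentiable_fun S \<psi>11" and "differentiable_fun S \<psi>12"
    and "differentiable_fun S \<psi>'11" and "differentiable_fun S \<psi>'12"
    and "\<And>x. x \<in> S \<Longrightarrow> z \<notin> spectrum_on D (A x)"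
    and "differentiable_fun S u" and "differentiable_fun S f" and "differentiable_fun S v"
    and "\<And>x. x \<in> S \<Longrightarrow> f x \<in> L2_on D"
    and "\<And>x. x \<in> S \<Longrightarrow> u x = vpair (u1 x) (u2 x)"
    and "\<And>x. x \<in> S \<Longrightarrow> v x = vpair (v1 x) (v2 x)"
    and "open_system S A B \<Phi> (sigma_A b L) (sigma_B L)
           (\<lambda>x t. exp (- z * of_real t) *s u x)
           (\<lambda>x t. exp (- z * of_real t) *\<^sub>C f x)
           (\<lambda>x t. exp (- z * of_real t) *s v x)"
  shows
    "(\<forall>x\<in>S. ddx S u x
        - \<i> *s (u x v* (z *\<^sub>M sigma_B L + \<psi> x) v* matrix_inv (sigma_A b L)) = 0) \<and>
     (\<forall>x\<in>S. ddx S v x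
        - \<i> *s (v x v* (z *\<^sub>M sigma_B L + \<psi>' x) v* matrix_inv (sigma_A b L)) = 0) \<and>
     ((\<forall>x\<in>S. \<psi>12 x = cadj (\<psi>12 x) \<and>
         - (\<psi>12 x ** L ** \<psi>11 x) + \<psi>11 x ** L ** cadj (\<psi>12 x) + ddx S \<psi>11 x = 0 \<and>
         \<psi>'12 x = cadj (\<psi>'12 x) \<and>
         - (\<psi>'12 x ** L ** \<psi>'11 x) + \<psi>'11 x ** L ** cadj (\<psi>'12 x) + ddx S \<psi>'11 x = 0)
      \<longrightarrow>
        sturm_liouville S (\<lambda>x. (L ** \<psi>12 x) ** (L ** \<psi>12 x) - L ** \<psi>11 x - L ** ddx S \<psi>12 x)
          (z / of_real b) u1 \<and>
        sturm_liouville S (\<lambda>x. (L ** \<psi>12 x) ** (L ** \<psi>12 x) - L ** \<psi>11 x + L ** ddx S \<psi>12 x)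
          (z / of_real b) u2 \<and>
        (\<forall>x\<in>S. v x = characteristic_op D (A x) (\<Phi> x) (sigma_A b L) z (u x)) \<and>
        sturm_liouville S (\<lambda>x. (L ** \<psi>'12 x) ** (L ** \<psi>'12 x) - L ** \<psi>'11 x - L ** ddx S \<psi>'12 x)
          (z / of_real b) v1 \<and>
        sturm_liouville S (\<lambda>x. (L ** \<psi>'12 x) ** (L ** \<psi>'12 x) - L ** \<psi>'11 x + L ** ddx S \<psi>'12 x)
          (z / of_real b) v2)"
proof -
  note model = assms(5) and B = assms(6) and A = assms(9) and \<Phi> = assms(10)
    and \<psi> = assms(13) and \<psi>' = assms(14) and diff_\<psi> = assms(17,18) and diff_\<psi>' = assms(19,20)
    and diff_u = assms(22) and diff_v = assms(24) and u = assms(26) and v = assms(27)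
  \<comment> \<open>The model data, and with them the properties of L, are available only at points
    of S, so one such point is needed.\<close>
  have "x0 \<in> S"
    using S \<open>x0 < x1\<close> by simp
  then have L: "cadj L = L" "invertible L"
    using model by (auto simp: triangular_model_data_def)
  have B_adjoint: "B x g \<bullet> h = g \<bullet> adjoint (B x) h" if "x \<in> S" for x g h
    using triangular_op_adjoint[OF model[OF that]] by (simp add: B[OF that])
  have B_scaleC: "B x (c *\<^sub>C g) = c *\<^sub>C B x g" if "x \<in> S" for x c g
    using triangular_op_scaleC[OF model[OF that]] by (simp add: B[OF that])
  have \<Phi>_adjoint: "\<Phi> x g \<bullet> h = g \<bullet> adjoint (\<Phi> x) h" if x: "x \<in> S" for x g h
  proof -
    obtain T where "\<And>f h. model_channel l (\<lambda>w. P w x) f \<bullet> h = f \<bullet> T h"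
      using model_channel_adjoint[OF model[OF x]] by blast
    then show ?thesis
      unfolding \<Phi>[OF x] by (rule double_channel_adjoint) (rule B_adjoint[OF x])
  qed
  interpret open_colligation x0 x1 D z A B \<Phi> "sigma_A b L" "sigma_B L" \<psi> \<psi>' u v f
  proof unfold_locales
    fix x c g h
    assume "x \<in> {x0..x1}"
    then have x: "x \<in> S"
      by (simp add: S)
    show "B x g \<bullet> h = g \<bullet> adjoint (B x) h"
      by (rule B_adjoint[OF x])
    show "\<Phi> x g \<bullet> h' = g \<bullet> adjoint (\<Phi> x) h'" for h'
      by (rule \<Phi>_adjoint[OF x])
    show "B x (c *\<^sub>C g) = c *\<^sub>C B x g"
      by (rule B_scaleC[OF x])
    show "A x (c *\<^sub>C g) = c *\<^sub>C A x g"
      by (simp add: A[OF x] B_scaleC[OF x] scaleC_of_real[symmetric] scaleC_scaleC mult.commute)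
    \<comment> \<open>Since b is real, the adjoint of b B^2 is b times the square of the adjoint of
      B.\<close>
    have "adjoint (A x) = (\<lambda>h. b *\<^sub>R adjoint (B x) (adjoint (B x) h))"
      by (rule adjoint_unique) (simp add: A[OF x] B_adjoint[OF x])
    then show "A x g \<bullet> h = g \<bullet> adjoint (A x) h"
      by (simp add: A[OF x] B_adjoint[OF x])
    show "\<Phi> x (c *\<^sub>C g) = c *s \<Phi> x g"
      \<comment> \<open>The second component of \<open>\<Phi> x\<close> involves the adjoint of B,
        whose complex homogeneity has to be derived first.\<close>
      using adjoint_scaleC[of "B x" "adjoint (B x)", OF B_adjoint[OF x] B_scaleC[OF x]]
      by (simp add: \<Phi>[OF x] double_channel_def model_channel_scaleC[OF model[OF x]] vpair_scale)
    show "f x \<in> L2_on D"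
      by (rule assms(25)[OF x])
  qed (use assms L in \<open>auto simp: cadj_sigma_A cadj_sigma_B\<close>)
  note input = input_compatibility[folded S] and output' = output_compatibility[folded S]
  note inv = invertible_sigma_A[OF L(2) \<open>b \<noteq> 0\<close>]
  have input_psi: "du v* sigma_A b L
      = \<i> *s (u x v* (z *\<^sub>M sigma_B L + psi_form b L (\<psi>11 x) (\<psi>12 x)))"
    if "x \<in> S" "(u has_vector_derivative du) (at x within S)" for x du
    using input[OF that] by (simp add: \<psi>[OF that(1)])
  have output_psi: "dv v* sigma_A b L
      = \<i> *s (v x v* (z *\<^sub>M sigma_B L + psi_form b L (\<psi>'11 x) (\<psi>'12 x)))"
    if "x \<in> S" "(v has_vector_derivative dv) (at x within S)" for x dv
    using output'[OF that] by (simp add: \<psi>'[OF that(1)])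
  show ?thesis
  proof (intro conjI impI ballI)
    show "ddx S u x - \<i> *s (u x v* (z *\<^sub>M sigma_B L + \<psi> x) v* matrix_inv (sigma_A b L)) = 0"
      if x: "x \<in> S" for x
      using vector_matrix_inv_mult[OF inv input[OF x vector_derivative_works[THEN iffD1]]] diff_u x
      by (simp add: scalar_vector_matrix_assoc)
    show "ddx S v x - \<i> *s (v x v* (z *\<^sub>M sigma_B L + \<psi>' x) v* matrix_inv (sigma_A b L)) = 0"
      if x: "x \<in> S" for x
      using vector_matrix_inv_mult[OF inv output'[OF x vector_derivative_works[THEN iffD1]]] diff_v x
      by (simp add: scalar_vector_matrix_assoc)
    show "v x = characteristic_op D (A x) (\<Phi> x) (sigma_A b L) z (u x)" if x: "x \<in> S" for x
      using output_eq_characteristic_op[folded S, OF x assms(21)[OF x]] .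
  \<comment> \<open>The same lemma is applied to u with \<open>\<psi>\<close> and to v with
    \<open>\<psi>'\<close>.\<close>
  qed (rule sturm_liouville_of_compatibility[OF S \<open>x0 < x1\<close> L(2) \<open>b \<noteq> 0\<close> u diff_u diff_\<psi> input_psi]
      sturm_liouville_of_compatibility[OF S \<open>x0 < x1\<close> L(2) \<open>b \<noteq> 0\<close> v diff_v diff_\<psi>' output_psi];
      blast)+
qed

end
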